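(* Let $k\in\{1,2\}$. Then \[ G_{(k,k,k-1)}(z,q) =\frac{1}{(zq;q)_{\infty}} \sum_{\substack{n_1,\dots,n_k\geq 0 \\ m_1,\dots,m_{k-1}\geq 0}} \frac{z^{n_1} q^{n_k^2}}{(q)_{n_1}} \prod_{i=1}^{k-1} q^{n_i^2-n_im_i+m_i^2}{n_i \brack n_{i+1}}{n_i-n_{i+1}+m_{i+1} \brack m_i}, \] and, for every integer $s$ with $1\leq s\leq k+1$, \[ G_{(3k-s,s-1,0)}(z,q) =\frac{1}{(zq;q)_{\infty}} \sum_{\substack{n_1,\dots,n_k\geq 0 \\ m_1,\dots,m_{k-1}\geq 0}} \frac{z^{n_1} q^{n_k^2+\sum_{i=s}^k n_i}}{(q)_{n_1}} \prod_{i=1}^{k-1} q^{n_i^2-n_im_i+m_i^2+m_i} {n_i \brack n_{i+1}} {n_i-n_{i+1}+m_{i+1} \brack m_i}, \] where $m_k:=2n_k$ in both identities.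
   Context: Cylindric partitions of rank 3: for a profile $c=(c_0,c_1,c_2)$ of nonnegative integers, a cylindric partition of profile $c$ is a triple $(\lambda^{(0)},\lambda^{(1)},\lambda^{(2)})$ of integer partitions (weakly decreasing sequences $(\lambda^{(i)}_1,\lambda^{(i)}_2,\dots)$ of nonnegative integers with finitely many nonzero terms) such that $\lambda^{(i)}_j\geq\lambda^{(i+1)}_{j+c_{i+1}}$ for all $j\geq1$ and $i=0,1,2$, where indices are read modulo 3 (so $\lambda^{(3)}=\lambda^{(0)}$ and $c_3=c_0$). Its size $|\pi|$ is the sum of all entries and $\max(\pi)$ is its largest entry. $G_c(z,q):=\sum_\pi z^{\max(\pi)}q^{|\pi|}$, summed over all cylindric partitions of profile $c$, a formal power series in $z,q$. Notation: $(a;q)_n=(a;q)_\infty/(aq^n;q)_\infty$, $(a;q)_\infty=\prod_{i\ge0}(1-aq^i)$, $(q)_n=(q;q)_n$; ${n\brack m}=\frac{(q)_n}{(q)_m(q)_{n-m}}$ if $0\leq m\leq n$ and $0$ otherwise. Empty sums are $0$, empty products $1$. *)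

theory Defs
  imports "HOL-Analysis.Analysis"
begin

(* Power series in z and q are series in q whose coefficients are series in z. Limits, infinite
   sums and infinite products are those of the q-adic topology that the library puts on fps: a
   family is summable iff for each n only finitely many members have a nonzero coefficient of
   q^n. The order of the variables matters: as series in z over series in q, the terms
   z^(max) q^(size) would not be summable, since infinitely many cylindric partitions can share
   the same maximum. *)
type_synonym zq_series = "rat fps fps"

abbreviation var_z :: zq_series where "var_z \<equiv> fps_const fps_X"

abbreviation var_q :: zq_series where "var_q \<equiv> fps_X"


(* The sequence is indexed from 0: the j-th part of the partition is f (j - 1). *)
definition is_partition :: "(nat \<Rightarrow> nat) \<Rightarrow> bool" where
  "is_partition f \<longleftrightarrow> antimono f \<and> finite {j. f j \<noteq> 0}"

type_synonym partition_triple = "(nat \<Rightarrow> nat) \<times> (nat \<Rightarrow> nat) \<times> (nat \<Rightarrow> nat)"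

definition cylindric_partitions :: "nat \<times> nat \<times> nat \<Rightarrow> partition_triple set" where
  "cylindric_partitions = (\<lambda>(c0, c1, c2). {(f0, f1, f2).
     is_partition f0 \<and> is_partition f1 \<and> is_partition f2 \<and>
     (\<forall>j. f0 j \<ge> f1 (j + c1)) \<and> (\<forall>j. f1 j \<ge> f2 (j + c2)) \<and> (\<forall>j. f2 j \<ge> f0 (j + c0))})"

definition partition_size :: "(nat \<Rightarrow> nat) \<Rightarrow> nat" where
  "partition_size f = (\<Sum>j | f j \<noteq> 0. f j)"

definition cp_size :: "partition_triple \<Rightarrow> nat" where
  "cp_size = (\<lambda>(f0, f1, f2). partition_size f0 + partition_size f1 + partition_size f2)"

definition cp_max :: "partition_triple \<Rightarrow> nat" where
  "cp_max = (\<lambda>(f0, f1, f2). Max (range f0 \<union> range f1 \<union> range f2))"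

definition cp_series :: "nat \<times> nat \<times> nat \<Rightarrow> zq_series" where
  "cp_series c = (\<Sum>\<^sub>\<infinity>\<pi>\<in>cylindric_partitions c. var_z ^ cp_max \<pi> * var_q ^ cp_size \<pi>)"


definition qpoch_inf :: "zq_series \<Rightarrow> zq_series" where
  "qpoch_inf a = (\<Prod>i. 1 - a * var_q ^ i)"

definition qpoch :: "zq_series \<Rightarrow> nat \<Rightarrow> zq_series" where
  "qpoch a n = qpoch_inf a / qpoch_inf (a * var_q ^ n)"

definition qbinom :: "int \<Rightarrow> int \<Rightarrow> zq_series" where
  "qbinom n m =
     (if 0 \<le> m \<and> m \<le> n
      then qpoch var_q (nat n) / (qpoch var_q (nat m) * qpoch var_q (nat (n - m)))
      else 0)"

(* Summation over n_1, ..., n_k, m_1, ..., m_{k-1}, with m_k := 2 n_k adjoined to the tuple.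
   The exponent n_i^2 - n_i m_i + m_i^2 of the summands is nonnegative; over nat it has to be
   written n_i^2 + m_i^2 - n_i m_i, with the subtraction last, so that nothing is truncated. *)
definition sum_indices :: "nat \<Rightarrow> ((nat \<Rightarrow> nat) \<times> (nat \<Rightarrow> nat)) set" where
  "sum_indices k =
     {(n, m). n \<in> {1..k} \<rightarrow>\<^sub>E UNIV \<and> m \<in> {1..k} \<rightarrow>\<^sub>E UNIV \<and> m k = 2 * n k}"


(* The remaining lemmas show that cp_series and the infinite products converge, so that no
   default value for divergence is involved, and that qpoch is the usual finite product. *)

lemma has_prod_qpoch_inf:
  assumes "fps_nth a 0 = 0"
  shows "(\<lambda>i. 1 - a * var_q ^ i) has_prod qpoch_inf a"
proof -
  have nz: "1 - a * var_q ^ i \<noteq> 0" for i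
  proof -
    have "fps_nth (1 - a * var_q ^ i) 0 = 1" using assms by simp
    thus ?thesis by (metis fps_zero_nth zero_neq_one)
  qed
  define F where "F = (\<lambda>n. \<Prod>i\<le>n. 1 - a * var_q ^ i)"
  have F0: "fps_nth (F n) 0 = 1" for n
    by (induction n) (use assms in \<open>simp_all add: F_def\<close>)
  have step: "fps_nth (F (n + d)) n = fps_nth (F n) n" for n d
  proof (induction d)
    case (Suc d)
    have "F (n + Suc d) = F (n + d) - (F (n + d) * a) * var_q ^ (Suc (n + d))"
      by (simp add: F_def algebra_simps)
    thus ?case using Suc by (simp add: fps_X_power_mult_right_nth del: power_Suc)
  qed simp
  define L where "L = Abs_fps (\<lambda>n. fps_nth (F n) n)"
  have "F \<longlonglongrightarrow> L"
  proof (rule tendsto_fpsI)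
    fix n
    show "eventually (\<lambda>x. fps_nth (F x) n = fps_nth L n) sequentially"
      using eventually_ge_at_top[of n]
      by eventually_elim (metis L_def fps_nth_Abs_fps le_Suc_ex step)
  qed
  moreover have "L \<noteq> 0"
    using F0[of 0] by (metis L_def fps_nth_Abs_fps fps_zero_nth zero_neq_one)
  ultimately have "(\<lambda>i. 1 - a * var_q ^ i) has_prod L"
    by (simp add: has_prod_def raw_has_prod_def F_def)
  thus ?thesis
    unfolding qpoch_inf_def by (simp add: has_prod_unique[symmetric])
qed

lemma qpoch_inf_nth_0:
  assumes "fps_nth a 0 = 0"
  shows "fps_nth (qpoch_inf a) 0 = 1"
proof -
  have "qpoch_inf a \<noteq> 0 \<and> (\<lambda>n. \<Prod>i\<le>n. 1 - a * var_q ^ i) \<longlonglongrightarrow> qpoch_inf a"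
  proof -
    have "fps_nth (1 - a * var_q ^ i) 0 = 1" for i using assms by simp
    hence "1 - a * var_q ^ i \<noteq> 0" for i by (metis fps_zero_nth zero_neq_one)
    thus ?thesis
      using has_prod_qpoch_inf[OF assms] by (auto simp: has_prod_def raw_has_prod_def)
  qed
  hence "eventually (\<lambda>n. fps_nth (\<Prod>i\<le>n. 1 - a * var_q ^ i) 0 = fps_nth (qpoch_inf a) 0) sequentially"
    by (auto simp: tendsto_fps_iff)
  then obtain n where "fps_nth (\<Prod>i\<le>n. 1 - a * var_q ^ i) 0 = fps_nth (qpoch_inf a) 0"
    by (auto simp: eventually_sequentially)
  moreover have "fps_nth (\<Prod>i\<le>n. 1 - a * var_q ^ i) 0 = 1" for n
    by (induction n) (use assms in simp_all)
  ultimately show ?thesis by simp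
qed

lemma qpoch_inf_rec:
  assumes "fps_nth a 0 = 0"
  shows "qpoch_inf a = (1 - a) * qpoch_inf (a * var_q)"
proof -
  have "(\<lambda>i. 1 - (a * var_q) * var_q ^ i) has_prod qpoch_inf (a * var_q)"
    by (rule has_prod_qpoch_inf) (use assms in simp)
  moreover have nz: "qpoch_inf (a * var_q) \<noteq> 0"
    using qpoch_inf_nth_0[of "a * var_q"] assms by auto
  ultimately have "(\<lambda>n. \<Prod>i\<le>n. 1 - (a * var_q) * var_q ^ i) \<longlonglongrightarrow> qpoch_inf (a * var_q)"
    by (auto simp: has_prod_def raw_has_prod_def)
  hence ev: "eventually (\<lambda>n. fps_nth (\<Prod>i\<le>n. 1 - (a * var_q) * var_q ^ i) N =
      fps_nth (qpoch_inf (a * var_q)) N) sequentially" for N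
    by (auto simp: tendsto_fps_iff)
  have shift: "(\<Prod>i\<le>Suc n. 1 - a * var_q ^ i) =
      (1 - a) * (\<Prod>i\<le>n. 1 - (a * var_q) * var_q ^ i)" for n
    by (subst prod.atMost_Suc_shift) (simp add: mult.assoc)
  have "(\<lambda>n. \<Prod>i\<le>Suc n. 1 - a * var_q ^ i) \<longlonglongrightarrow> (1 - a) * qpoch_inf (a * var_q)"
    unfolding shift
  proof (rule tendsto_fpsI)
    fix N
    have "eventually (\<lambda>n. \<forall>M\<in>{..N}. fps_nth (\<Prod>i\<le>n. 1 - (a * var_q) * var_q ^ i) M =
        fps_nth (qpoch_inf (a * var_q)) M) sequentially"
      by (subst eventually_ball_finite_distrib) (use ev in auto)
    thus "eventually (\<lambda>n. fps_nth ((1 - a) * (\<Prod>i\<le>n. 1 - (a * var_q) * var_q ^ i)) N =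
        fps_nth ((1 - a) * qpoch_inf (a * var_q)) N) sequentially"
      by eventually_elim (auto simp: fps_mult_nth intro!: sum.cong)
  qed
  moreover have "(\<lambda>n. \<Prod>i\<le>Suc n. 1 - a * var_q ^ i) \<longlonglongrightarrow> qpoch_inf a"
  proof -
    have "qpoch_inf a \<noteq> 0"
      using qpoch_inf_nth_0[OF assms] by auto
    hence "(\<lambda>n. \<Prod>i\<le>n. 1 - a * var_q ^ i) \<longlonglongrightarrow> qpoch_inf a"
      using has_prod_qpoch_inf[OF assms] by (auto simp: has_prod_def raw_has_prod_def)
    thus ?thesis by (rule LIMSEQ_Suc)
  qed
  ultimately show ?thesis using LIMSEQ_unique by blast
qed

lemma qpoch_eq_prod:
  assumes "fps_nth a 0 = 0"
  shows "qpoch a n = (\<Prod>i<n. 1 - a * var_q ^ i)"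
proof -
  let ?Q = "qpoch_inf (a * var_q ^ n)"
  have *: "qpoch_inf a = (\<Prod>i<n. 1 - a * var_q ^ i) * qpoch_inf (a * var_q ^ n)"
  proof (induction n)
    case (Suc n)
    have "qpoch_inf (a * var_q ^ n) = (1 - a * var_q ^ n) * qpoch_inf (a * var_q ^ n * var_q)"
      by (rule qpoch_inf_rec) (use assms in simp)
    thus ?case using Suc by (simp add: mult_ac)
  qed simp
  have Q0: "fps_nth ?Q 0 = 1"
    by (rule qpoch_inf_nth_0) (use assms in simp)
  have "?Q * inverse ?Q = 1"
    unfolding fps_inverse_def[of ?Q] by (rule fps_right_inverse) (simp add: Q0)
  hence "qpoch_inf a * inverse ?Q = (\<Prod>i<n. 1 - a * var_q ^ i)"
    by (subst *) (simp add: mult.assoc)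
  moreover have "qpoch a n = qpoch_inf a * inverse ?Q"
    unfolding qpoch_def by (rule fps_divide_unit) (simp add: Q0)
  ultimately show ?thesis by simp
qed

lemma is_partition_bounds:
  assumes "is_partition f"
  shows "f j \<le> partition_size f" and "partition_size f \<le> j \<Longrightarrow> f j = 0"
proof -
  have fin: "finite {j. f j \<noteq> 0}" and anti: "antimono f"
    using assms by (auto simp: is_partition_def)
  show "f j \<le> partition_size f"
    unfolding partition_size_def using fin
    by (cases "f j = 0") (auto intro: member_le_sum)
  show "f j = 0" if "partition_size f \<le> j"
  proof (rule ccontr)
    assume nz: "f j \<noteq> 0"
    have sub: "{..j} \<subseteq> {i. f i \<noteq> 0}"
    proof
      fix i assume "i \<in> {..j}"
      hence "f j \<le> f i" using anti by (auto simp: antimono_def)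
      thus "i \<in> {i. f i \<noteq> 0}" using nz by simp
    qed
    have "j + 1 = card {..j}" by simp
    also have "\<dots> \<le> card {i. f i \<noteq> 0}" using sub fin by (rule card_mono[rotated])
    also have "\<dots> = (\<Sum>i | f i \<noteq> 0. 1)" by simp
    also have "\<dots> \<le> partition_size f"
      unfolding partition_size_def by (rule sum_mono) auto
    finally show False using that by simp
  qed
qed

lemma finite_cylindric_partitions_of_size:
  "finite {\<pi> \<in> cylindric_partitions c. cp_size \<pi> = n}"
proof -
  define S where "S = {f::nat \<Rightarrow> nat. \<forall>j. (j \<in> {..n} \<longrightarrow> f j \<in> {..n}) \<and> (j \<notin> {..n} \<longrightarrow> f j = 0)}"
  have "finite S" unfolding S_def by (intro finite_set_of_finite_funs) auto
  have "f \<in> S" if "is_partition f" "partition_size f \<le> n" for f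
    unfolding S_def using is_partition_bounds[OF that(1)] that(2)
    by (auto intro: le_trans)
  hence "{\<pi> \<in> cylindric_partitions c. cp_size \<pi> = n} \<subseteq> S \<times> S \<times> S"
    by (auto simp: cylindric_partitions_def cp_size_def split: prod.splits)
  thus ?thesis using \<open>finite S\<close> by (meson finite_SigmaI finite_subset)
qed

lemma summable_cp_series:
  "(\<lambda>\<pi>. var_z ^ cp_max \<pi> * var_q ^ cp_size \<pi>) summable_on cylindric_partitions c"
proof -
  let ?f = "\<lambda>\<pi>. var_z ^ cp_max \<pi> * var_q ^ cp_size \<pi>"
  have "finite {\<pi> \<in> cylindric_partitions c. fps_nth (?f \<pi>) n \<noteq> 0}" for n
    by (rule finite_subset[OF _ finite_cylindric_partitions_of_size[of c n]])
       (auto simp: fps_X_power_mult_right_nth fps_const_power split: if_splits)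
  hence "(?f has_sum Abs_fps (\<lambda>n. \<Sum>\<pi> | \<pi> \<in> cylindric_partitions c \<and> fps_nth (?f \<pi>) n \<noteq> 0.
            fps_nth (?f \<pi>) n)) (cylindric_partitions c)"
    by (intro has_sum_fpsI) simp_all
  thus ?thesis by (auto simp: summable_on_def)
qed

end

(* Let A_c(n) be the generating function of the cylindric partitions of profile c with all parts at
   most n. Removing the first part of every row of a set J of rows that start with n changes the
   profile to c(J), so inclusion-exclusion over J gives
     A_c(n) - A_c(n-1) = sum over nonempty J of (-1)^(|J|-1) q^(|J| n) A_{c(J)}(n),
   where J ranges over sets of rows i with c_i > 0 (the equations of Corteel and Welsh). For a fixed
   level c_0 + c_1 + c_2 this system determines all A_c from A_c(0) = 1, because of the factors
   q^(|J| n). By Euler's expansion of 1/(z;q)_inf it remains to find h_c(r) such that the sums of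
   h_c(r) / (q)_{n-r} over r satisfy the same system. At level 5, seven profiles up to rotation are
   involved. All of their h_c are combinations of double sums with weights q^(a j + b m) that obey
   four contiguous relations, and the system follows from these relations by linear algebra. *)

theory Submission
  imports Defs "HOL-Computational_Algebra.Formal_Laurent_Series"
begin

section \<open>Contiguous relations\<close>

text \<open>As G_c / (1 - z) is the sum of A_c(n) z^n, the h_c(n) must be the coefficients of z^n in
  (zq;q)_inf G_c. The theorem thus prescribes h_c for four of the seven profiles, and the system
  does not close on these: the equation of (4,1,0) already involves (4,0,1) and (3,1,1). Candidates
  for the other three have to be supplied; after that only verification and uniqueness remain. In
  terms of h_c the equations reach back to n - 1 and n - 2, so two of the four contiguous relations
  have to lower n. These relations and the candidate for (3,1,1) divide by q^n; hence the algebra is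
  done over a field, and the results are carried back to power series at the end. For k = 1 the
  level 3k - 1 is 2, and h_c(n) is simply q^(n^2) / (q)_n, with an additional factor q^n for
  (2,0,0).\<close>

definition qfact :: "'a::comm_ring_1 \<Rightarrow> nat \<Rightarrow> 'a" where
  "qfact q n = (\<Prod>i<n. 1 - q ^ Suc i)"

lemma qfact_0 [simp]: "qfact q 0 = 1"
  by (simp add: qfact_def)

lemma qfact_Suc: "qfact q (Suc n) = (1 - q ^ Suc n) * qfact q n"
  by (simp add: qfact_def mult.commute)

lemmas power_expand = power_numeral_even power_numeral_odd Let_def

locale q_field =
  fixes q :: "'a::field"
  assumes q_nonzero: "q \<noteq> 0"
    and q_power_neq_1: "k > 0 \<Longrightarrow> q ^ k \<noteq> 1"
begin

declare q_nonzero [simp]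

lemma qfact_nonzero: "qfact q n \<noteq> 0"
  using q_power_neq_1 by (auto simp: qfact_def simp del: power_Suc)

lemma powi_neq_1: "n \<noteq> 0 \<Longrightarrow> q powi n \<noteq> 1"
  using q_power_neq_1[of "nat n"] q_power_neq_1[of "nat (-n)"]
  by (cases "n > 0") (auto simp: power_int_def power_inverse)

lemma powi_nonzero [simp]: "q powi n \<noteq> 0"
  by (simp add: q_nonzero)

lemma powi_add: "q powi (m + n) = q powi m * q powi n"
  by (simp add: power_int_add q_nonzero)

lemma powi_numeral_mult: "q powi (numeral k * m) = (q powi m) ^ numeral k"
  by (subst mult.commute) (simp only: power_int_mult power_int_numeral)

lemma powi_diff: "q powi (m - n) = q powi m / q powi n"
  by (simp add: power_int_diff q_nonzero)

text \<open>The reciprocal of (q)_n, continued by 0 to negative n: this is the extension for which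
  \<open>iqf_rec\<close> holds for all integers, at n = 0 because 1 - q^0 = 0.\<close>

definition iqf :: "int \<Rightarrow> 'a" where
  "iqf n = (if n < 0 then 0 else inverse (qfact q (nat n)))"

lemma iqf_neg [simp]: "n < 0 \<Longrightarrow> iqf n = 0"
  by (simp add: iqf_def)

lemma iqf_0 [simp]: "iqf 0 = 1"
  by (simp add: iqf_def)

lemma iqf_rec: "(1 - q powi n) * iqf n = iqf (n - 1)"
proof (cases "n > 0")
  case True
  then obtain m where m: "n = int (Suc m)"
    by (metis Suc_pred zero_less_imp_eq_int of_nat_0_less_iff)
  have "1 - q ^ Suc m \<noteq> 0"
    using q_power_neq_1[of "Suc m"] by simp
  then show ?thesis
    using qfact_nonzero[of m]
    by (simp add: m iqf_def qfact_Suc power_int_def nat_add_distrib right_inverse_eq del: power_Suc)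
next
  case False
  then show ?thesis by (cases "n = 0") auto
qed

text \<open>The sum of \<open>q\<close> to the power \<open>m\<^sup>2 + c m\<close> times the \<open>q\<close>-binomial coefficient of \<open>L\<close> and \<open>m\<close>, defined by its
  Pascal recurrence; \<open>qsum_eq\<close> is the explicit form.\<close>

fun qsum :: "nat \<Rightarrow> int \<Rightarrow> 'a" where
  "qsum 0 c = 1"
| "qsum (Suc L) c = qsum L c + q powi (int L + 1 + c) * qsum L (c + 1)"

text \<open>In the explicit sums the left side carries the weight 1 - q^m, and (1 - q^(m+1))
  [L, m+1] = (1 - q^(L-m)) [L, m] applies after a shift of m. The proof stays with the recurrence:
  the defect of the claim at (L + 1, c) is its defect at (L, c) plus q^(L+c+2) times that at (L, c +
  1).\<close>

lemma qsum_contig: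
  "qsum L c - qsum L (c + 1) = q powi (c + 1) * (qsum L (c + 2) - q ^ L * qsum L (c + 1))"
proof (induction L arbitrary: c)
  case (Suc L)
  define A where "A = q powi c"
  define B where "B = q ^ L"
  have e: "q powi (int L + 1 + c) = A * B * q" "q powi (int L + 1 + (c + 1)) = A * B * q * q"
    "q powi (int L + 1 + (c + 2)) = A * B * q * q * q" "q powi (c + 1) = A * q" "q powi (c + 2) = A * q * q"
    by (simp_all add: A_def B_def powi_add power2_eq_square power3_eq_cube)
  have r: "qsum (Suc L) c = qsum L c + A * B * q * qsum L (c + 1)"
    "qsum (Suc L) (c + 1) = qsum L (c + 1) + A * B * q * q * qsum L (c + 2)"
    "qsum (Suc L) (c + 2) = qsum L (c + 2) + A * B * q * q * q * qsum L (c + 3)"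
    by (simp_all only: qsum.simps e) (simp_all add: add.assoc)
  have i1: "qsum L c - qsum L (c + 1) = A * q * (qsum L (c + 2) - B * qsum L (c + 1))"
    using Suc[of c] by (simp add: e B_def)
  have i2: "qsum L (c + 1) - qsum L (c + 2) = A * q * q * (qsum L (c + 3) - B * qsum L (c + 2))"
    using Suc[of "c + 1"] by (simp add: e B_def add.assoc)
  have "qsum (Suc L) c - qsum (Suc L) (c + 1) - q powi (c + 1) * (qsum (Suc L) (c + 2) - q ^ Suc L * qsum (Suc L) (c + 1))
    = (qsum L c - qsum L (c + 1) - A * q * (qsum L (c + 2) - B * qsum L (c + 1)))
      + A * q * q * B * (qsum L (c + 1) - qsum L (c + 2) - A * q * q * (qsum L (c + 3) - B * qsum L (c + 2)))"
    unfolding r e(4) by (simp add: B_def[symmetric] algebra_simps)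
  also have "\<dots> = 0" using i1 i2 by simp
  finally show ?case by simp
qed simp

text \<open>For \<open>a = b = 0\<close> this is the inner sum over \<open>n\<^sub>2 = j\<close> and \<open>m\<^sub>1\<close> (hidden in \<open>qsum\<close>) of
  the first identity for \<open>k = 2\<close> and \<open>n\<^sub>1 = n\<close>, divided by \<open>(q)\<^sub>n\<close>; \<open>a\<close> and \<open>b\<close> insert the weight
  \<open>q\<close> to the power \<open>a n\<^sub>2 + b m\<^sub>1\<close>. Integer indices, with value 0 for \<open>n < 0\<close>, avoid case distinctions
  at the boundary.\<close>

definition s :: "int \<Rightarrow> int \<Rightarrow> int \<Rightarrow> 'a" where
  "s a b n = (\<Sum>j\<in>{0..n}. q powi (n * n + j * j + a * j) * iqf j * iqf (n - j) * qsum (nat (n + j)) (b - n))"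

lemma s_neg [simp]: "n < 0 \<Longrightarrow> s a b n = 0"
  by (simp add: s_def)

lemma s_extend: 
  assumes "n \<le> k"
  shows "s a b n = (\<Sum>j\<in>{0..k}. q powi (n * n + j * j + a * j) * iqf j * iqf (n - j) * qsum (nat (n + j)) (b - n))"
  unfolding s_def by (rule sum.mono_neutral_left) (use assms in auto)

lemma sum_shift_int:
  fixes g :: "int \<Rightarrow> 'b::comm_monoid_add"
  assumes "g 0 = 0" "g (n + 1) = 0"
  shows "(\<Sum>j\<in>{0..n}. g j) = (\<Sum>j\<in>{0..n}. g (j + 1))"
proof -
  have "(\<Sum>j\<in>{0..n}. g j) = (\<Sum>j\<in>{1..n+1}. g j)"
    by (rule sum.mono_neutral_cong) (use assms in \<open>auto simp: order_class.le_less zle_iff_zadd\<close>)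
  also have "\<dots> = (\<Sum>j\<in>{0..n}. g (j + 1))"
    by (rule sum.reindex_bij_witness[of _ "\<lambda>j. j + 1" "\<lambda>j. j - 1"]) auto
  finally show ?thesis .
qed

text \<open>Termwise \<open>qsum_contig\<close> with c = b - n and L = n + j: of the factor q^L, the
  part q^n cancels against q^c and the part q^j raises a by 1.\<close>

lemma s_contig1:
  "s a b n - s a (b + 1) n = q powi (b + 1) * (s a (b + 2) n / q powi n - s (a + 1) (b + 1) n)"
proof -
  have "q powi (n * n + j * j + a * j) * iqf j * iqf (n - j) * qsum (nat (n + j)) (b - n)
      - q powi (n * n + j * j + a * j) * iqf j * iqf (n - j) * qsum (nat (n + j)) (b + 1 - n)
    = q powi (b + 1) * (q powi (n * n + j * j + a * j) * iqf j * iqf (n - j) * qsum (nat (n + j)) (b + 2 - n) / q powi n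
      - q powi (n * n + j * j + (a + 1) * j) * iqf j * iqf (n - j) * qsum (nat (n + j)) (b + 1 - n))"
    if "j \<in> {0..n}" for j
  proof -
    have "q ^ nat (n + j) = q powi (n + j)" using that by (simp add: power_int_def)
    then have *: "qsum (nat (n + j)) (b - n) = qsum (nat (n + j)) (b + 1 - n) + 
        q powi (b - n + 1) * (qsum (nat (n + j)) (b + 2 - n) - q powi (n + j) * qsum (nat (n + j)) (b + 1 - n))"
      using qsum_contig[of "nat (n + j)" "b - n"] by (simp add: algebra_simps)
    define R where "R = q powi (n * n + j * j + a * j) * iqf j * iqf (n - j)"
    have R: "q powi (n * n + j * j + (a + 1) * j) * iqf j * iqf (n - j) = R * q powi j"
      by (simp add: R_def powi_add distrib_right)
    have e: "q powi (b - n + 1) = q powi b * q / q powi n" "q powi (b + 1) = q powi b * q" 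
       "q powi (n + j) = q powi n * q powi j"
      by (simp_all add: powi_add powi_diff)
    show ?thesis unfolding * R unfolding R_def[symmetric] unfolding e
      using powi_nonzero[of n]
      by (simp add: field_simps)
  qed
  then show ?thesis
    unfolding s_def sum_divide_distrib sum_subtractf[symmetric] sum_distrib_left
    by (intro sum.cong) auto
qed

text \<open>The left side puts the weight 1 - q^(n-j) on the terms, which lowers 1/(q)_(n-j) to
  1/(q)_(n-1-j); one step of the recurrence of \<open>qsum\<close> then takes n + j to n - 1 +
  j.\<close>

lemma s_rec1:
  "s a b n - q powi n * s (a - 1) b n
    = (q powi n)\<^sup>2 / q * (s a (b - 1) (n - 1) + q powi b * s (a + 1) b (n - 1))"
proof -
  have "q powi (n * n + j * j + a * j) * iqf j * iqf (n - j) * qsum (nat (n + j)) (b - n)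
      - q powi n * (q powi (n * n + j * j + (a - 1) * j) * iqf j * iqf (n - j) * qsum (nat (n + j)) (b - n))
    = (q powi n)\<^sup>2 / q * (q powi ((n - 1) * (n - 1) + j * j + a * j) * iqf j * iqf (n - 1 - j) * qsum (nat (n - 1 + j)) (b - 1 - (n - 1))
      + q powi b * (q powi ((n - 1) * (n - 1) + j * j + (a + 1) * j) * iqf j * iqf (n - 1 - j) * qsum (nat (n - 1 + j)) (b - (n - 1))))"
     (is "?l = ?r")
    if "j \<in> {0..n}" for j
  proof -
    define R where "R = q powi (n * n + j * j + a * j) * iqf j"
    have "?l = R * ((1 - q powi (n - j)) * iqf (n - j)) * qsum (nat (n + j)) (b - n)"
      by (simp add: R_def powi_add powi_diff ring_distribs; simp add: field_simps)
    also have "\<dots> = R * iqf (n - 1 - j) * qsum (nat (n + j)) (b - n)"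
      unfolding iqf_rec by (simp add: algebra_simps)
    also have "\<dots> = ?r"
    \<comment> \<open>At j = n both sides contain \<open>iqf\<close> of -1. For j < n the number n -
      1 + j is nonnegative, as the recurrence of \<open>qsum\<close> under \<open>nat\<close>
      requires.\<close>
    proof (cases "j = n")
      case False
      then have "nat (n + j) = Suc (nat (n - 1 + j))" "int (nat (n - 1 + j)) = n - 1 + j"
        using that by auto
      then have "qsum (nat (n + j)) (b - n) = qsum (nat (n - 1 + j)) (b - n) + q powi (j + b) * qsum (nat (n - 1 + j)) (b + 1 - n)"
        by (simp add: algebra_simps)
      then show ?thesis
        by (simp add: R_def powi_add powi_diff ring_distribs powi_numeral_mult power_expand; simp add: field_simps)
    qed auto
    finally show ?thesis .
  qed
  then show ?thesis
    unfolding s_extend[of n n, OF order_refl] s_extend[of "n - 1" n, simplified] sum_divide_distrib sum_subtractf[symmetric] sum_distrib_left sum.distrib[symmetric]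
    by (intro sum.cong) auto
qed

text \<open>The weight 1 - q^j lowers 1/(q)_j to 1/(q)_(j-1); shifting j by one restores it, and
  (j+1)^2 + a (j+1) yields the new weight a + 2 and the factor q^(a+1). Both \<open>s_rec2\<close>
  and \<open>s_contig2\<close> start from this form.\<close>

lemma s_shift:
  "s a b n - s (a + 1) b n
    = (\<Sum>j\<in>{0..n}. q powi (a + 1) * (q powi (n * n + j * j + (a + 2) * j) * iqf j * iqf (n - 1 - j) * qsum (nat (n + j + 1)) (b - n)))"
proof -
  have "s a b n - s (a + 1) b n = (\<Sum>j\<in>{0..n}. q powi (n * n + j * j + a * j) * iqf (j - 1) * iqf (n - j) * qsum (nat (n + j)) (b - n))"
    unfolding s_def sum_subtractf[symmetric]
    by (intro sum.cong refl) (simp add: powi_add powi_diff ring_distribs iqf_rec[symmetric] mult_ac)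
  also have "\<dots> = (\<Sum>j\<in>{0..n}. q powi (n * n + (j + 1) * (j + 1) + a * (j + 1)) * iqf (j + 1 - 1) * iqf (n - (j + 1)) * qsum (nat (n + (j + 1))) (b - n))"
    by (rule sum_shift_int) auto
  also have "\<dots> = (\<Sum>j\<in>{0..n}. q powi (a + 1) * (q powi (n * n + j * j + (a + 2) * j) * iqf j * iqf (n - 1 - j) * qsum (nat (n + j + 1)) (b - n)))"
    by (intro sum.cong refl) (simp add: powi_add powi_diff ring_distribs algebra_simps power2_eq_square)
  finally show ?thesis .
qed

text \<open>Two steps of the recurrence of \<open>qsum\<close> take n + j + 1 in
  \<open>s_shift\<close> down to n - 1 + j, so that every term belongs to n - 1; 1 + q collects the
  two mixed paths.\<close>

lemma s_rec2:
  "s a b n - s (a + 1) b n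
    = q powi a * (q powi n)\<^sup>2 * (s (a + 2) (b - 1) (n - 1) + (1 + q) * q powi b * s (a + 3) b (n - 1)
        + (q powi b)\<^sup>2 * q\<^sup>2 * s (a + 4) (b + 1) (n - 1))"
proof -
  have "q powi (a + 1) * (q powi (n * n + j * j + (a + 2) * j) * iqf j * iqf (n - 1 - j) * qsum (nat (n + j + 1)) (b - n))
     = q powi a * (q powi n)\<^sup>2 * (q powi ((n - 1) * (n - 1) + j * j + (a + 2) * j) * iqf j * iqf (n - 1 - j) * qsum (nat (n - 1 + j)) (b - 1 - (n - 1))
      + (1 + q) * q powi b * (q powi ((n - 1) * (n - 1) + j * j + (a + 3) * j) * iqf j * iqf (n - 1 - j) * qsum (nat (n - 1 + j)) (b - (n - 1)))
      + (q powi b)\<^sup>2 * q\<^sup>2 * (q powi ((n - 1) * (n - 1) + j * j + (a + 4) * j) * iqf j * iqf (n - 1 - j) * qsum (nat (n - 1 + j)) (b + 1 - (n - 1))))"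
     (is "?l = ?r")
    if "j \<in> {0..n}" for j
  proof (cases "j = n")
    case False
    then have "nat (n + j + 1) = Suc (Suc (nat (n - 1 + j)))" "int (nat (n - 1 + j)) = n - 1 + j"
      using that by auto
    then have "qsum (nat (n + j + 1)) (b - n) = qsum (nat (n - 1 + j)) (b - n)
         + (1 + q) * q powi (j + b) * qsum (nat (n - 1 + j)) (b + 1 - n)
         + q powi (2 * j + 2 * b + 2) * qsum (nat (n - 1 + j)) (b + 2 - n)"
      by (simp add: add.assoc add.commute[of 2] powi_add powi_diff powi_numeral_mult power2_eq_square; simp add: field_simps powi_add powi_diff)
    then show ?thesis
      by (simp add: powi_add powi_diff ring_distribs powi_numeral_mult power_expand; simp add: field_simps)
  qed auto
  then show ?thesis
    unfolding s_shift s_extend[of "n - 1" n, simplified] sum_distrib_left sum.distrib[symmetric]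
    by (intro sum.cong) auto
qed

text \<open>The other evaluation of \<open>s_shift\<close>, at the same n: one step of the
  recurrence of \<open>qsum\<close>, and 1/(q)_(n-1-j) written back as (1 -
  q^(n-j))/(q)_(n-j).\<close>

lemma s_contig2:
  "s a b n - s (a + 1) b n
    = q powi (a + 1) * (s (a + 2) b n - q powi n * s (a + 1) b n
        + q powi (b + 1) * (s (a + 3) (b + 1) n - q powi n * s (a + 2) (b + 1) n))"
proof -
  have "q powi (a + 1) * (q powi (n * n + j * j + (a + 2) * j) * iqf j * iqf (n - 1 - j) * qsum (nat (n + j + 1)) (b - n))
     = q powi (a + 1) * (q powi (n * n + j * j + (a + 2) * j) * iqf j * iqf (n - j) * qsum (nat (n + j)) (b - n) 
        - q powi n * (q powi (n * n + j * j + (a + 1) * j) * iqf j * iqf (n - j) * qsum (nat (n + j)) (b - n))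
        + q powi (b + 1) * (q powi (n * n + j * j + (a + 3) * j) * iqf j * iqf (n - j) * qsum (nat (n + j)) (b + 1 - n) 
        - q powi n * (q powi (n * n + j * j + (a + 2) * j) * iqf j * iqf (n - j) * qsum (nat (n + j)) (b + 1 - n))))"
     (is "?l = ?r")
    if "j \<in> {0..n}" for j
  proof -
    have "nat (n + j + 1) = Suc (nat (n + j))" "int (nat (n + j)) = n + j"
      using that by auto
    then have *: "qsum (nat (n + j + 1)) (b - n) = qsum (nat (n + j)) (b - n) + q powi (j + b + 1) * qsum (nat (n + j)) (b + 1 - n)"
      by (simp add: algebra_simps)
    have **: "iqf (n - 1 - j) = (1 - q powi (n - j)) * iqf (n - j)"
      using iqf_rec[of "n - j"] by (simp add: algebra_simps)
    show ?thesis unfolding * **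
      by (simp add: powi_add powi_diff ring_distribs powi_numeral_mult power_expand; simp add: field_simps)
  qed
  then show ?thesis
    unfolding s_shift unfolding s_def sum_distrib_left sum_subtractf[symmetric] sum.distrib[symmetric]
    by (intro sum.cong) auto
qed


subsection \<open>The functional equations at level 5\<close>

text \<open>\<open>opj\<close> is the effect on the coefficients of \<open>z\<close> of the substitution of \<open>z q\<^sup>j\<close> for \<open>z\<close> followed by
  multiplication with \<open>(zq;q)\<close> of index \<open>j - 1\<close>. This is the form that the functional equations of the
  \<open>G\<^sub>c\<close> take after multiplication with \<open>(zq;q)\<close> of infinite index.\<close>

definition op1 :: "(int \<Rightarrow> 'a) \<Rightarrow> int \<Rightarrow> 'a" where
  "op1 g n = q powi n * g n"

definition op2 :: "(int \<Rightarrow> 'a) \<Rightarrow> int \<Rightarrow> 'a" where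
  "op2 g n = (q powi n)\<^sup>2 * (g n - g (n - 1) / q)"

definition op3 :: "(int \<Rightarrow> 'a) \<Rightarrow> int \<Rightarrow> 'a" where
  "op3 g n = (q powi n) ^ 3 * (g n - (1 / q + 1 / q\<^sup>2) * g (n - 1) + g (n - 2) / q ^ 3)"

text \<open>The coefficients of \<open>z\<close> in \<open>G\<^sub>c\<close> times \<open>(zq;q)\<close> of infinite index, for the seven profiles \<open>c\<close> of level 5
  up to rotation. The expressions for the profiles (3,0,2), (3,1,1) and (4,0,1), which are not part of
  the theorem, were found by fitting combinations of the double sums to computed data.\<close>

definition h500 :: "int \<Rightarrow> 'a" where "h500 n = q powi n * s 1 1 n"
definition h410 :: "int \<Rightarrow> 'a" where "h410 n = s 1 1 n"
definition h320 :: "int \<Rightarrow> 'a" where "h320 n = s 0 1 n"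
definition h221 :: "int \<Rightarrow> 'a" where "h221 n = s 0 0 n"
definition h302 :: "int \<Rightarrow> 'a" where "h302 n = s 1 1 n + q powi n * (s 0 0 n - s 0 1 n)"
definition h311 :: "int \<Rightarrow> 'a" where "h311 n = (1 - q * q powi n) * s 1 1 n + q / q powi n * s 1 2 n"
definition h401 :: "int \<Rightarrow> 'a" where "h401 n = q powi n * h311 n + (q powi n)\<^sup>2 / q * s 1 1 (n - 1)"

lemmas rec_defs = op1_def op2_def op3_def h500_def h410_def h320_def h221_def h302_def h311_def h401_def

lemma rec500: "h500 n = op1 h410 n"
  by (simp add: rec_defs)

text \<open>\<open>h401\<close> is the right side already simplified: the terms in
  \<open>s 1 1 n\<close> of \<open>op1 h500\<close> and \<open>op2 h410\<close> cancel.\<close>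

lemma rec401: "h401 n = op1 h311 n + op1 h500 n - op2 h410 n"
  by (simp add: rec_defs field_simps power2_eq_square)

text \<open>In the remaining equations, the multipliers of the contiguous relations were found by computer,
  by linear algebra over the field of rational functions in \<open>q\<close> and \<open>N = q\<^sup>n\<close>.\<close>

lemma rec410: "h410 n = op1 h320 n + op1 h401 n - op2 h311 n"
proof -
  define N where "N = q powi n"
  have N: "N \<noteq> 0" "q powi n = N" "q powi (n - 1) = N / q" "q powi (n - 2) = N / q\<^sup>2"
    by (simp_all add: N_def powi_diff)
  have r0: "s 1 0 (n - 1) - s 1 1 (n - 1) - (q * (s 1 2 (n - 1) / (N / q) - s 2 1 (n - 1))) = 0"
    using s_contig1[of 1 0 "(n - 1)"] by (simp add: N power2_eq_square power_expand mult_ac inverse_eq_divide)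
  have r1: "s 1 1 n - N * s 0 1 n - (N\<^sup>2 / q * (s 1 0 (n - 1) + q * s 2 1 (n - 1))) = 0"
    using s_rec1[of 1 1 "n"] by (simp add: N power2_eq_square power_expand mult_ac inverse_eq_divide)
  \<comment> \<open>The values of \<open>s\<close> act as unknowns here: the claim is an identity of
    linear forms in them over the rational functions in q and N, and every bracket is a relation
    known to vanish.\<close>
  have "h410 n - (op1 h320 n + op1 h401 n - op2 h311 n)
    = (1/q) * N ^ 2 * (s 1 0 (n - 1) - s 1 1 (n - 1) - (q * (s 1 2 (n - 1) / (N / q) - s 2 1 (n - 1))))
      + (s 1 1 n - N * s 0 1 n - (N\<^sup>2 / q * (s 1 0 (n - 1) + q * s 2 1 (n - 1))))"
    unfolding rec_defs N using N(1) by (simp add: field_simps power2_eq_square power3_eq_cube power_expand)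
  also have "\<dots> = 0"
    unfolding r0 r1 by simp
  finally show ?thesis by simp
qed

text \<open>Both \<open>h302 n - op1 h221 n\<close> and \<open>h410 n - op1 h320 n\<close> equal s 1
  1 n - N s 0 1 n, and the other terms are those of \<open>rec410\<close>, so the same relations
  with the same multipliers prove it.\<close>

lemma rec302: "h302 n = op1 h221 n + op1 h401 n - op2 h311 n"
proof -
  define N where "N = q powi n"
  have N: "N \<noteq> 0" "q powi n = N" "q powi (n - 1) = N / q" "q powi (n - 2) = N / q\<^sup>2"
    by (simp_all add: N_def powi_diff)
  have r0: "s 1 0 (n - 1) - s 1 1 (n - 1) - (q * (s 1 2 (n - 1) / (N / q) - s 2 1 (n - 1))) = 0"
    using s_contig1[of 1 0 "(n - 1)"] by (simp add: N power2_eq_square power_expand mult_ac inverse_eq_divide)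
  have r1: "s 1 1 n - N * s 0 1 n - (N\<^sup>2 / q * (s 1 0 (n - 1) + q * s 2 1 (n - 1))) = 0"
    using s_rec1[of 1 1 "n"] by (simp add: N power2_eq_square power_expand mult_ac inverse_eq_divide)
  have "h302 n - (op1 h221 n + op1 h401 n - op2 h311 n)
    = (1/q) * N ^ 2 * (s 1 0 (n - 1) - s 1 1 (n - 1) - (q * (s 1 2 (n - 1) / (N / q) - s 2 1 (n - 1))))
      + (s 1 1 n - N * s 0 1 n - (N\<^sup>2 / q * (s 1 0 (n - 1) + q * s 2 1 (n - 1))))"
    unfolding rec_defs N using N(1) by (simp add: field_simps power2_eq_square power3_eq_cube power_expand)
  also have "\<dots> = 0"
    unfolding r0 r1 by simp
  finally show ?thesis by simp
qed

lemma s_0 [simp]: "s a b 0 = 1"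
  by (simp add: s_def)

lemma rec320: "h320 n = op1 h302 n + op1 h311 n - op2 h221 n"
proof -
  define N where "N = q powi n"
  have N: "N \<noteq> 0" "q powi n = N" "q powi (n - 1) = N / q" "q powi (n - 2) = N / q\<^sup>2"
    by (simp_all add: N_def powi_diff)
  have r0: "s 0 0 n - s 0 1 n - (q * (s 0 2 n / N - s 1 1 n)) = 0"
    using s_contig1[of 0 0 "n"] by (simp add: N power2_eq_square power_expand mult_ac inverse_eq_divide)
  have r1: "s 1 0 n - s 1 1 n - (q * (s 1 2 n / N - s 2 1 n)) = 0"
    using s_contig1[of 1 0 "n"] by (simp add: N power2_eq_square power_expand mult_ac inverse_eq_divide)
  have r2: "s 1 0 n - s 1 1 n - (q * (s 1 2 n / N - s 2 1 n)) = 0"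
    using s_contig1[of 1 0 "n"] by (simp add: N power2_eq_square power_expand mult_ac inverse_eq_divide)
  have r3: "s 2 0 n - s 2 1 n - (q * (s 2 2 n / N - s 3 1 n)) = 0"
    using s_contig1[of 2 0 "n"] by (simp add: N power2_eq_square power_expand mult_ac inverse_eq_divide)
  have r4: "s 2 0 (n - 1) - s 2 1 (n - 1) - (q * (s 2 2 (n - 1) / (N / q) - s 3 1 (n - 1))) = 0"
    using s_contig1[of 2 0 "(n - 1)"] by (simp add: N power2_eq_square power_expand mult_ac inverse_eq_divide)
  have r5: "s 0 1 n - N * s (-1) 1 n - (N\<^sup>2 / q * (s 0 0 (n - 1) + q * s 1 1 (n - 1))) = 0"
    using s_rec1[of 0 1 "n"] by (simp add: N power2_eq_square power_expand mult_ac inverse_eq_divide)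
  have r6: "s 1 1 n - N * s 0 1 n - (N\<^sup>2 / q * (s 1 0 (n - 1) + q * s 2 1 (n - 1))) = 0"
    using s_rec1[of 1 1 "n"] by (simp add: N power2_eq_square power_expand mult_ac inverse_eq_divide)
  have r7: "s 1 2 n - N * s 0 2 n - (N\<^sup>2 / q * (s 1 1 (n - 1) + q ^ 2 * s 2 2 (n - 1))) = 0"
    using s_rec1[of 1 2 "n"] by (simp add: N power2_eq_square power_expand mult_ac inverse_eq_divide)
  have r8: "s 2 2 n - N * s 1 2 n - (N\<^sup>2 / q * (s 2 1 (n - 1) + q ^ 2 * s 3 2 (n - 1))) = 0"
    using s_rec1[of 2 2 "n"] by (simp add: N power2_eq_square power_expand mult_ac inverse_eq_divide)
  have r9: "s (-1) 1 n - s 0 1 n - (1 / q * N\<^sup>2 * (s 1 0 (n - 1) + (1 + q) * q * s 2 1 (n - 1) + q ^ 4 * s 3 2 (n - 1))) = 0"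
    using s_rec2[of "-1" 1 "n"] by (simp add: N power2_eq_square power_expand mult_ac inverse_eq_divide)
  have r10: "s (-1) 1 n - s 0 1 n - ((s 1 1 n - N * s 0 1 n + q ^ 2 * (s 2 2 n - N * s 1 2 n))) = 0"
    using s_contig2[of "-1" 1 "n"] by (simp add: N power2_eq_square power_expand mult_ac inverse_eq_divide)
  have r11: "s 0 0 n - s 1 0 n - (q * (s 2 0 n - N * s 1 0 n + q * (s 3 1 n - N * s 2 1 n))) = 0"
    using s_contig2[of "0" 0 "n"] by (simp add: N power2_eq_square power_expand mult_ac inverse_eq_divide)
  have r12: "s 0 0 (n - 1) - s 1 0 (n - 1) - (q * (s 2 0 (n - 1) - (N / q) * s 1 0 (n - 1) + q * (s 3 1 (n - 1) - (N / q) * s 2 1 (n - 1)))) = 0"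
    using s_contig2[of "0" 0 "(n - 1)"] by (simp add: N power2_eq_square power_expand mult_ac inverse_eq_divide)
  \<comment> \<open>The contiguous relations yield this equation only up to the factor \<open>1 - N\<close>, which vanishes for \<open>n = 0\<close>.\<close>
  have "(1 - N) * (h320 n - (op1 h302 n + op1 h311 n - op2 h221 n))
    = N ^ 2 * (s 0 0 n - s 0 1 n - (q * (s 0 2 n / N - s 1 1 n)))
      + (-1) * N ^ 2 * (s 1 0 n - s 1 1 n - (q * (s 1 2 n / N - s 2 1 n)))
      + q * N ^ 3 * (s 1 0 n - s 1 1 n - (q * (s 1 2 n / N - s 2 1 n)))
      + (-q) * N ^ 2 * (s 2 0 n - s 2 1 n - (q * (s 2 2 n / N - s 3 1 n)))
      + N ^ 3 * (s 2 0 (n - 1) - s 2 1 (n - 1) - (q * (s 2 2 (n - 1) / (N / q) - s 3 1 (n - 1))))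
      + (s 0 1 n - N * s (-1) 1 n - (N\<^sup>2 / q * (s 0 0 (n - 1) + q * s 1 1 (n - 1))))
      + N ^ 2 * (s 1 1 n - N * s 0 1 n - (N\<^sup>2 / q * (s 1 0 (n - 1) + q * s 2 1 (n - 1))))
      + (-q) * (s 1 2 n - N * s 0 2 n - (N\<^sup>2 / q * (s 1 1 (n - 1) + q ^ 2 * s 2 2 (n - 1))))
      + q ^ 2 * N * (s 2 2 n - N * s 1 2 n - (N\<^sup>2 / q * (s 2 1 (n - 1) + q ^ 2 * s 3 2 (n - 1))))
      + (-1) * N * (s (-1) 1 n - s 0 1 n - (1 / q * N\<^sup>2 * (s 1 0 (n - 1) + (1 + q) * q * s 2 1 (n - 1) + q ^ 4 * s 3 2 (n - 1))))
      + 2 * N * (s (-1) 1 n - s 0 1 n - ((s 1 1 n - N * s 0 1 n + q ^ 2 * (s 2 2 n - N * s 1 2 n))))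
      + (-1) * N ^ 2 * (s 0 0 n - s 1 0 n - (q * (s 2 0 n - N * s 1 0 n + q * (s 3 1 n - N * s 2 1 n))))
      + (1/q) * N ^ 3 * (s 0 0 (n - 1) - s 1 0 (n - 1) - (q * (s 2 0 (n - 1) - (N / q) * s 1 0 (n - 1) + q * (s 3 1 (n - 1) - (N / q) * s 2 1 (n - 1)))))"
    unfolding rec_defs N using N(1) by (simp add: field_simps power2_eq_square power3_eq_cube power_expand)
  also have "\<dots> = 0"
    unfolding r0 r1 r2 r3 r4 r5 r6 r7 r8 r9 r10 r11 r12 by simp
  \<comment> \<open>For n = 0 the values of \<open>s\<close> at 0 are 1 and those at -1 are 0, and
    the equation reads 1 = 1 + 1 - 1.\<close>
  finally show ?thesis
    using powi_neq_1[of n] N by (cases "n = 0") (auto simp: rec_defs)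
qed

text \<open>\<open>op3\<close> reaches back to n - 2, and so does \<open>op2 h401\<close> through
  \<open>h401 (n - 1)\<close>; hence relations at n, n - 1 and n - 2.\<close>

lemma rec311: "h311 n = op1 h221 n + op1 h302 n + op1 h410 n - op2 h221 n - op2 h320 n - op2 h401 n + op3 h311 n"
proof -
  define N where "N = q powi n"
  have N: "N \<noteq> 0" "q powi n = N" "q powi (n - 1) = N / q" "q powi (n - 2) = N / q\<^sup>2"
    by (simp_all add: N_def powi_diff)
  have r0: "s 1 0 n - s 1 1 n - (q * (s 1 2 n / N - s 2 1 n)) = 0"
    using s_contig1[of 1 0 "n"] by (simp add: N power2_eq_square power_expand mult_ac inverse_eq_divide)
  have r1: "s 1 (-1) (n - 1) - s 1 0 (n - 1) - ((s 1 1 (n - 1) / (N / q) - s 2 0 (n - 1))) = 0"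
    using s_contig1[of 1 "-1" "(n - 1)"] by (simp add: N power2_eq_square power_expand mult_ac inverse_eq_divide)
  have r2: "s 1 0 (n - 1) - s 1 1 (n - 1) - (q * (s 1 2 (n - 1) / (N / q) - s 2 1 (n - 1))) = 0"
    using s_contig1[of 1 0 "(n - 1)"] by (simp add: N power2_eq_square power_expand mult_ac inverse_eq_divide)
  have r3: "s 1 0 (n - 2) - s 1 1 (n - 2) - (q * (s 1 2 (n - 2) / (N / q\<^sup>2) - s 2 1 (n - 2))) = 0"
    using s_contig1[of 1 0 "(n - 2)"] by (simp add: N power2_eq_square power_expand mult_ac inverse_eq_divide)
  have r4: "s 1 1 n - N * s 0 1 n - (N\<^sup>2 / q * (s 1 0 (n - 1) + q * s 2 1 (n - 1))) = 0"
    using s_rec1[of 1 1 "n"] by (simp add: N power2_eq_square power_expand mult_ac inverse_eq_divide)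
  have r5: "s 1 1 (n - 1) - (N / q) * s 0 1 (n - 1) - ((N / q)\<^sup>2 / q * (s 1 0 (n - 2) + q * s 2 1 (n - 2))) = 0"
    using s_rec1[of 1 1 "(n - 1)"] by (simp add: N power2_eq_square power_expand mult_ac inverse_eq_divide)
  have r6: "s (-1) 0 n - s 0 0 n - (1 / q * N\<^sup>2 * (s 1 (-1) (n - 1) + (1 + q) * s 2 0 (n - 1) + q ^ 2 * s 3 1 (n - 1))) = 0"
    using s_rec2[of "-1" 0 "n"] by (simp add: N power2_eq_square power_expand mult_ac inverse_eq_divide)
  have r7: "s (-1) 0 n - s 0 0 n - ((s 1 0 n - N * s 0 0 n + q * (s 2 1 n - N * s 1 1 n))) = 0"
    using s_contig2[of "-1" 0 "n"] by (simp add: N power2_eq_square power_expand mult_ac inverse_eq_divide)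
  have r8: "s 0 0 (n - 1) - s 1 0 (n - 1) - (q * (s 2 0 (n - 1) - (N / q) * s 1 0 (n - 1) + q * (s 3 1 (n - 1) - (N / q) * s 2 1 (n - 1)))) = 0"
    using s_contig2[of "0" 0 "(n - 1)"] by (simp add: N power2_eq_square power_expand mult_ac inverse_eq_divide)
  have "h311 n - (op1 h221 n + op1 h302 n + op1 h410 n - op2 h221 n - op2 h320 n - op2 h401 n + op3 h311 n)
    = (-1) * (s 1 0 n - s 1 1 n - (q * (s 1 2 n / N - s 2 1 n)))
      + (1/q) * N ^ 2 * (s 1 (-1) (n - 1) - s 1 0 (n - 1) - ((s 1 1 (n - 1) / (N / q) - s 2 0 (n - 1))))
      + (-1/q) * N ^ 3 * (s 1 0 (n - 1) - s 1 1 (n - 1) - (q * (s 1 2 (n - 1) / (N / q) - s 2 1 (n - 1))))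
      + (1/q^3) * N ^ 3 * (s 1 0 (n - 2) - s 1 1 (n - 2) - (q * (s 1 2 (n - 2) / (N / q\<^sup>2) - s 2 1 (n - 2))))
      + (-2) * N * (s 1 1 n - N * s 0 1 n - (N\<^sup>2 / q * (s 1 0 (n - 1) + q * s 2 1 (n - 1))))
      + N * (s 1 1 (n - 1) - (N / q) * s 0 1 (n - 1) - ((N / q)\<^sup>2 / q * (s 1 0 (n - 2) + q * s 2 1 (n - 2))))
      + (s (-1) 0 n - s 0 0 n - (1 / q * N\<^sup>2 * (s 1 (-1) (n - 1) + (1 + q) * s 2 0 (n - 1) + q ^ 2 * s 3 1 (n - 1))))
      + (-1) * (s (-1) 0 n - s 0 0 n - ((s 1 0 n - N * s 0 0 n + q * (s 2 1 n - N * s 1 1 n))))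
      + (-1/q) * N ^ 2 * (s 0 0 (n - 1) - s 1 0 (n - 1) - (q * (s 2 0 (n - 1) - (N / q) * s 1 0 (n - 1) + q * (s 3 1 (n - 1) - (N / q) * s 2 1 (n - 1)))))"
    unfolding rec_defs N using N(1) by (simp add: field_simps power2_eq_square power3_eq_cube power_expand)
  also have "\<dots> = 0"
    unfolding r0 r1 r2 r3 r4 r5 r6 r7 r8 by simp
  finally show ?thesis by simp
qed

text \<open>\<open>rec320\<close> at n and n - 1 (\<open>e0\<close>, \<open>e1\<close>) joins the
  contiguous relations as two further known zeros, so that no factor 1 - N has to be divided out
  here.\<close>

lemma rec221: "h221 n = op1 h311 n + op1 h221 n + op1 h320 n - op2 h221 n - op2 h302 n - op2 h311 n + op3 h221 n"
proof -
  define N where "N = q powi n"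
  have N: "N \<noteq> 0" "q powi n = N" "q powi (n - 1) = N / q" "q powi (n - 2) = N / q\<^sup>2"
    by (simp_all add: N_def powi_diff)
  have r0: "s 1 0 n - s 1 1 n - (q * (s 1 2 n / N - s 2 1 n)) = 0"
    using s_contig1[of 1 0 "n"] by (simp add: N power2_eq_square power_expand mult_ac inverse_eq_divide)
  have r1: "s 0 (-1) (n - 1) - s 0 0 (n - 1) - ((s 0 1 (n - 1) / (N / q) - s 1 0 (n - 1))) = 0"
    using s_contig1[of 0 "-1" "(n - 1)"] by (simp add: N power2_eq_square power_expand mult_ac inverse_eq_divide)
  have r2: "s 0 0 n - N * s (-1) 0 n - (N\<^sup>2 / q * (s 0 (-1) (n - 1) + s 1 0 (n - 1))) = 0"
    using s_rec1[of 0 0 "n"] by (simp add: N power2_eq_square power_expand mult_ac inverse_eq_divide)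
  have r3: "s (-1) 0 n - s 0 0 n - ((s 1 0 n - N * s 0 0 n + q * (s 2 1 n - N * s 1 1 n))) = 0"
    using s_contig2[of "-1" 0 "n"] by (simp add: N power2_eq_square power_expand mult_ac inverse_eq_divide)
  have e0: "h320 n - (op1 h302 n + op1 h311 n - op2 h221 n) = 0"
    by (simp add: rec320[symmetric])
  have e1: "h320 (n - 1) - (op1 h302 (n - 1) + op1 h311 (n - 1) - op2 h221 (n - 1)) = 0"
    by (simp add: rec320[symmetric])
  have "h221 n - (op1 h311 n + op1 h221 n + op1 h320 n - op2 h221 n - op2 h302 n - op2 h311 n + op3 h221 n)
    = N * (s 1 0 n - s 1 1 n - (q * (s 1 2 n / N - s 2 1 n)))
      + (1/q) * N ^ 2 * (s 0 (-1) (n - 1) - s 0 0 (n - 1) - ((s 0 1 (n - 1) / (N / q) - s 1 0 (n - 1))))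
      + (s 0 0 n - N * s (-1) 0 n - (N\<^sup>2 / q * (s 0 (-1) (n - 1) + s 1 0 (n - 1))))
      + N * (s (-1) 0 n - s 0 0 n - ((s 1 0 n - N * s 0 0 n + q * (s 2 1 n - N * s 1 1 n))))
      + (- N) * (h320 n - (op1 h302 n + op1 h311 n - op2 h221 n))
      + N * (h320 (n - 1) - (op1 h302 (n - 1) + op1 h311 (n - 1) - op2 h221 (n - 1)))"
    unfolding rec_defs N using N(1) by (simp add: field_simps power2_eq_square power3_eq_cube power_expand)
  also have "\<dots> = 0"
    unfolding r0 r1 r2 r3 e0 e1 by simp
  finally show ?thesis by simp
qed


subsection \<open>Convolution with the reciprocals of the q-factorials\<close>

definition gauss :: "nat \<Rightarrow> nat \<Rightarrow> 'a" where
  "gauss n m = (if m \<le> n then qfact q n / (qfact q m * qfact q (n - m)) else 0)"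

lemma gauss_0 [simp]: "gauss n 0 = 1"
  using qfact_nonzero[of n] by (simp add: gauss_def)

lemma gauss_eq_0 [simp]: "n < m \<Longrightarrow> gauss n m = 0"
  by (simp add: gauss_def)

text \<open>Over the common denominator this is 1 - q^(n+1) = (1 - q^(n-m)) + q^(n-m) (1 - q^(m+1)).
  Of the two q-analogues of Pascal's rule, this one fits the recurrence of
  \<open>qsum\<close>.\<close>

lemma gauss_pascal:
  assumes "m \<le> n"
  shows "gauss (Suc n) (Suc m) = gauss n (Suc m) + q ^ (n - m) * gauss n m"
proof (cases "m = n")
  case True
  then show ?thesis using qfact_nonzero by (simp add: gauss_def)
next
  case False
  with assms obtain d where d: "n = Suc (m + d)"
    by (metis add_Suc_right le_neq_implies_less less_imp_Suc_add)
  have nz: "1 - q ^ Suc m \<noteq> 0" "1 - q ^ Suc d \<noteq> 0"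
    using q_power_neq_1[of "Suc m"] q_power_neq_1[of "Suc d"] by auto
  have "gauss (Suc n) (Suc m) = (1 - q ^ Suc n) * qfact q n / ((1 - q ^ Suc m) * qfact q m * ((1 - q ^ Suc d) * qfact q d))"
    by (simp add: gauss_def d qfact_Suc[of q "Suc (m + d)"] qfact_Suc[of q m] qfact_Suc[of q d] del: power_Suc)
  moreover have "gauss n (Suc m) = qfact q n / ((1 - q ^ Suc m) * qfact q m * qfact q d)"
    by (simp add: gauss_def d qfact_Suc[of q m] del: power_Suc)
  moreover have "gauss n m = qfact q n / (qfact q m * ((1 - q ^ Suc d) * qfact q d))"
    by (simp add: gauss_def d qfact_Suc[of q d] Suc_diff_le del: power_Suc)
  moreover have "1 - q ^ Suc n = (1 - q ^ Suc d) + q ^ Suc d * (1 - q ^ Suc m)"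
    by (simp add: d power_add algebra_simps)
  moreover have "n - m = Suc d" by (simp add: d)
  moreover have "(B + Q * A) * z / (A * x * (B * y)) = z / (A * x * y) + Q * (z / (x * (B * y)))"
    if "A \<noteq> 0" "B \<noteq> 0" "x \<noteq> 0" "y \<noteq> 0" for A B Q x y z :: 'a
    using that by (simp add: field_simps)
  ultimately show ?thesis
    using nz qfact_nonzero[of m] qfact_nonzero[of d] by metis
qed

text \<open>Pascal's rule at m + 1 gives a second term with exponent (m+1)^2 + c (m+1) + L - m = (L
  + 1 + c) + m^2 + (c+1) m: a common factor and the same sum with c + 1, as in the
  recurrence.\<close>

lemma qsum_eq: "qsum L c = (\<Sum>m\<le>L. q powi (int m * int m + c * int m) * gauss L m)"
proof (induction L arbitrary: c)
  case (Suc L)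
  let ?t = "\<lambda>m. q powi (int m * int m + c * int m)"
  have "(\<Sum>m\<le>Suc L. ?t m * gauss (Suc L) m) = 1 + (\<Sum>m\<le>L. ?t (Suc m) * gauss (Suc L) (Suc m))"
    by (subst sum.atMost_Suc_shift) simp
  also have "(\<Sum>m\<le>L. ?t (Suc m) * gauss (Suc L) (Suc m))
      = (\<Sum>m\<le>L. ?t (Suc m) * gauss L (Suc m) + q powi (int L + 1 + c) * (q powi (int m * int m + (c + 1) * int m) * gauss L m))"
  proof (intro sum.cong refl)
    fix m assume "m \<in> {..L}"
    then have m: "m \<le> L" by simp
    have "?t (Suc m) * q ^ (L - m) = q powi (int (Suc m) * int (Suc m) + c * int (Suc m) + int (L - m))"
      by (simp only: powi_add power_int_of_nat)
    also have "\<dots> = q powi (int L + 1 + c + (int m * int m + (c + 1) * int m))"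
      by (rule arg_cong[where f = "\<lambda>x. q powi x"]) (use m in \<open>simp add: of_nat_diff algebra_simps\<close>)
    finally have "?t (Suc m) * q ^ (L - m) = q powi (int L + 1 + c) * q powi (int m * int m + (c + 1) * int m)"
      by (simp only: powi_add)
    then show "?t (Suc m) * gauss (Suc L) (Suc m) = ?t (Suc m) * gauss L (Suc m) + q powi (int L + 1 + c) * (q powi (int m * int m + (c + 1) * int m) * gauss L m)"
      unfolding gauss_pascal[OF m] distrib_left mult.assoc[symmetric] by simp
  qed
  also have "1 + \<dots> = (1 + (\<Sum>m\<le>L. ?t (Suc m) * gauss L (Suc m))) + q powi (int L + 1 + c) * qsum L (c + 1)"
    by (simp only: sum.distrib Suc.IH sum_distrib_left add.assoc)
  also have "1 + (\<Sum>m\<le>L. ?t (Suc m) * gauss L (Suc m)) = (\<Sum>m\<le>Suc L. ?t m * gauss L m)"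
    by (subst sum.atMost_Suc_shift) simp
  also have "\<dots> = qsum L c"
    by (simp add: Suc.IH)
  finally show ?case by simp
qed simp

text \<open>The coefficient of z^n in g(z) / (z;q)_inf, for g(z) the series with coefficients
  \<open>g\<close>; \<open>bdiff\<close> is multiplication by 1 - z.\<close>

definition conv :: "(int \<Rightarrow> 'a) \<Rightarrow> int \<Rightarrow> 'a" where
  "conv g n = (\<Sum>r\<in>{0..n}. g r * iqf (n - r))"

definition bdiff :: "(int \<Rightarrow> 'a) \<Rightarrow> int \<Rightarrow> 'a" where
  "bdiff g n = g n - g (n - 1)"

lemma conv_bdiff:
  assumes "g (-1) = 0"
  shows "conv (bdiff g) n = conv g n - conv g (n - 1)"
proof -
  have "(\<Sum>r\<in>{0..n}. g (r - 1) * iqf (n - r)) = (\<Sum>r\<in>{0..n}. g (r + 1 - 1) * iqf (n - (r + 1)))"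
    by (rule sum_shift_int) (use assms in auto)
  also have "\<dots> = conv g (n - 1)"
    unfolding conv_def
    by (rule sum.mono_neutral_cong_right) (auto simp: algebra_simps)
  finally show ?thesis
    by (simp add: conv_def bdiff_def left_diff_distrib sum_subtractf)
qed

text \<open>In terms of series, (1 - z) / (z;q)_inf = 1 / (zq;q)_inf, whose coefficients are q^k /
  (q)_k.\<close>

lemma conv_bdiff_iqf:
  "conv g n - conv g (n - 1) = (\<Sum>r\<in>{0..n}. g r * (q powi (n - r) * iqf (n - r)))"
proof -
  have "conv g (n - 1) = (\<Sum>r\<in>{0..n}. g r * iqf (n - r - 1))"
    unfolding conv_def
    by (rule sum.mono_neutral_cong_left) (auto simp: algebra_simps)
  also have "\<dots> = (\<Sum>r\<in>{0..n}. g r * iqf (n - r) - g r * (q powi (n - r) * iqf (n - r)))"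
    by (intro sum.cong refl) (simp only: iqf_rec[symmetric], simp add: algebra_simps)
  finally show ?thesis
    by (simp add: conv_def sum_subtractf)
qed

text \<open>(1 - z) g(zq) / (z;q)_inf = g(zq) / (zq;q)_inf, which is g(z) / (z;q)_inf with zq for z;
  the substitution multiplies the coefficient of z^n by q^n.\<close>

lemma conv_op1:
  assumes "g (-1) = 0"
  shows "conv (bdiff (op1 g)) n = q powi n * conv g n"
proof -
  have "conv (bdiff (op1 g)) n = (\<Sum>r\<in>{0..n}. op1 g r * (q powi (n - r) * iqf (n - r)))"
    using assms by (subst conv_bdiff) (auto simp: op1_def conv_bdiff_iqf)
  also have "\<dots> = (\<Sum>r\<in>{0..n}. q powi n * (g r * iqf (n - r)))"
    by (intro sum.cong refl) (simp add: op1_def powi_diff)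
  finally show ?thesis by (simp add: conv_def sum_distrib_left)
qed

text \<open>With \<open>bdiff\<close> between successive copies of \<open>op1\<close>,
  \<open>conv_op1\<close> can be iterated and gives the factors q^(2n) and q^(3n).\<close>

lemma op2_eq: "op2 g = op1 (bdiff (op1 g))"
  by (rule ext) (simp add: op1_def op2_def bdiff_def powi_diff power2_eq_square field_simps)

lemma op3_eq: "op3 g = op1 (bdiff (op1 (bdiff (op1 g))))"
  by (rule ext) (simp add: op1_def op3_def bdiff_def powi_diff power2_eq_square power3_eq_cube field_simps)

lemma conv_op2:
  assumes "\<And>r. r < 0 \<Longrightarrow> g r = 0"
  shows "conv (bdiff (op2 g)) n = (q powi n)\<^sup>2 * conv g n"
  unfolding op2_eq by (subst conv_op1; (subst conv_op1)?) (use assms in \<open>auto simp: op1_def bdiff_def power2_eq_square\<close>)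

lemma conv_op3:
  assumes "\<And>r. r < 0 \<Longrightarrow> g r = 0"
  shows "conv (bdiff (op3 g)) n = (q powi n) ^ 3 * conv g n"
proof -
  have "conv (bdiff (op3 g)) n = q powi n * conv (bdiff (op1 (bdiff (op1 g)))) n"
    unfolding op3_eq by (rule conv_op1) (use assms in \<open>auto simp: op1_def bdiff_def\<close>)
  also have "conv (bdiff (op1 (bdiff (op1 g)))) n = (q powi n)\<^sup>2 * conv g n"
    using conv_op2[of g n] assms by (simp add: op2_eq)
  finally show ?thesis by (simp add: power3_eq_cube power2_eq_square)
qed

lemma conv_0: "conv g 0 = g 0"
  by (simp add: conv_def)

lemma conv_neg: "n < 0 \<Longrightarrow> conv g n = 0"
  by (simp add: conv_def)

lemma conv_add: "conv (\<lambda>r. g r + h r) n = conv g n + conv h n"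
  by (simp add: conv_def distrib_right sum.distrib)

lemma conv_diff: "conv (\<lambda>r. g r - h r) n = conv g n - conv h n"
  by (simp add: conv_def left_diff_distrib sum_subtractf)

lemma bdiff_add: "bdiff (\<lambda>r. g r + h r) = (\<lambda>r. bdiff g r + bdiff h r)"
  by (rule ext) (simp add: bdiff_def)

lemma bdiff_minus: "bdiff (\<lambda>r. g r - h r) = (\<lambda>r. bdiff g r - bdiff h r)"
  by (rule ext) (simp add: bdiff_def)

lemma h_neg [simp]:
  assumes "n < 0"
  shows "h500 n = 0" "h410 n = 0" "h320 n = 0" "h221 n = 0" "h302 n = 0" "h311 n = 0" "h401 n = 0"
  using assms by (simp_all add: rec_defs)

lemmas conv_rules = conv_add conv_diff bdiff_add bdiff_minus conv_op1 conv_op2 conv_op3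

lemma conv_rec:
  "conv h500 n - conv h500 (n - 1) = q powi n * conv h410 n"
  "conv h410 n - conv h410 (n - 1) = q powi n * conv h320 n + q powi n * conv h401 n - (q powi n)\<^sup>2 * conv h311 n"
  "conv h401 n - conv h401 (n - 1) = q powi n * conv h311 n + q powi n * conv h500 n - (q powi n)\<^sup>2 * conv h410 n"
  "conv h320 n - conv h320 (n - 1) = q powi n * conv h302 n + q powi n * conv h311 n - (q powi n)\<^sup>2 * conv h221 n"
  "conv h302 n - conv h302 (n - 1) = q powi n * conv h221 n + q powi n * conv h401 n - (q powi n)\<^sup>2 * conv h311 n"
  "conv h311 n - conv h311 (n - 1) = q powi n * conv h221 n + q powi n * conv h302 n + q powi n * conv h410 n
     - (q powi n)\<^sup>2 * conv h221 n - (q powi n)\<^sup>2 * conv h320 n - (q powi n)\<^sup>2 * conv h401 n + (q powi n) ^ 3 * conv h311 n"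
  "conv h221 n - conv h221 (n - 1) = q powi n * conv h311 n + q powi n * conv h221 n + q powi n * conv h320 n
     - (q powi n)\<^sup>2 * conv h221 n - (q powi n)\<^sup>2 * conv h302 n - (q powi n)\<^sup>2 * conv h311 n + (q powi n) ^ 3 * conv h221 n"
proof -
  \<comment> \<open>Equations between functions, since \<open>conv\<close> and \<open>bdiff\<close>
    take functions. As rewrite rules they would loop, hence the single \<open>subst\<close> for each
    of them below.\<close>
  have *: "h500 = (\<lambda>n. op1 h410 n)" 
    "h410 = (\<lambda>n. op1 h320 n + op1 h401 n - op2 h311 n)"
    "h401 = (\<lambda>n. op1 h311 n + op1 h500 n - op2 h410 n)"
    "h320 = (\<lambda>n. op1 h302 n + op1 h311 n - op2 h221 n)"
    "h302 = (\<lambda>n. op1 h221 n + op1 h401 n - op2 h311 n)"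
    "h311 = (\<lambda>n. op1 h221 n + op1 h302 n + op1 h410 n - op2 h221 n - op2 h320 n - op2 h401 n + op3 h311 n)"
    "h221 = (\<lambda>n. op1 h311 n + op1 h221 n + op1 h320 n - op2 h221 n - op2 h302 n - op2 h311 n + op3 h221 n)"
    by (rule ext, rule rec500 rec410 rec401 rec320 rec302 rec311 rec221)+
  show "conv h500 n - conv h500 (n - 1) = q powi n * conv h410 n"
    by (subst conv_bdiff[symmetric], simp) (subst *(1), simp add: conv_rules)
  show "conv h410 n - conv h410 (n - 1) = q powi n * conv h320 n + q powi n * conv h401 n - (q powi n)\<^sup>2 * conv h311 n"
    by (subst conv_bdiff[symmetric], simp) (subst *(2), simp add: conv_rules)
  show "conv h401 n - conv h401 (n - 1) = q powi n * conv h311 n + q powi n * conv h500 n - (q powi n)\<^sup>2 * conv h410 n"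
    by (subst conv_bdiff[symmetric], simp) (subst *(3), simp add: conv_rules)
  show "conv h320 n - conv h320 (n - 1) = q powi n * conv h302 n + q powi n * conv h311 n - (q powi n)\<^sup>2 * conv h221 n"
    by (subst conv_bdiff[symmetric], simp) (subst *(4), simp add: conv_rules)
  show "conv h302 n - conv h302 (n - 1) = q powi n * conv h221 n + q powi n * conv h401 n - (q powi n)\<^sup>2 * conv h311 n"
    by (subst conv_bdiff[symmetric], simp) (subst *(5), simp add: conv_rules)
  show "conv h311 n - conv h311 (n - 1) = q powi n * conv h221 n + q powi n * conv h302 n + q powi n * conv h410 n
     - (q powi n)\<^sup>2 * conv h221 n - (q powi n)\<^sup>2 * conv h320 n - (q powi n)\<^sup>2 * conv h401 n + (q powi n) ^ 3 * conv h311 n"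
    by (subst conv_bdiff[symmetric], simp) (subst *(6), simp add: conv_rules)
  show "conv h221 n - conv h221 (n - 1) = q powi n * conv h311 n + q powi n * conv h221 n + q powi n * conv h320 n
     - (q powi n)\<^sup>2 * conv h221 n - (q powi n)\<^sup>2 * conv h302 n - (q powi n)\<^sup>2 * conv h311 n + (q powi n) ^ 3 * conv h221 n"
    by (subst conv_bdiff[symmetric], simp) (subst *(7), simp add: conv_rules)
qed

section \<open>The two profiles of level 2\<close>

definition h110 :: "int \<Rightarrow> 'a" where "h110 n = q powi (n * n) * iqf n"
definition h200 :: "int \<Rightarrow> 'a" where "h200 n = q powi n * h110 n"

lemma h_neg2 [simp]: "n < 0 \<Longrightarrow> h110 n = 0" "n < 0 \<Longrightarrow> h200 n = 0"
  by (simp_all add: h110_def h200_def)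

text \<open>\<open>iqf_rec\<close> expresses \<open>h110 (n - 1)\<close> as q^(1-2n) (1 - q^n) times
  \<open>h110 n\<close>; everything is then a multiple of \<open>h110 n\<close>.\<close>

lemma rec110: "h110 n = op1 h200 n + op1 h110 n - op2 h110 n"
proof -
  have "q powi ((n - 1) * (n - 1)) = q * q powi (n * n) / (q powi n)\<^sup>2"
  proof -
    have "(n - 1) * (n - 1) = n * n - n - n + 1" by (simp add: algebra_simps)
    then show ?thesis by (simp only: powi_add powi_diff) (simp add: power2_eq_square)
  qed
  then have "h110 (n - 1) = q * q powi (n * n) / (q powi n)\<^sup>2 * ((1 - q powi n) * iqf n)"
    unfolding h110_def iqf_rec by simp
  then show ?thesis
    by (simp add: op1_def op2_def h200_def h110_def power2_eq_square field_simps)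
qed

lemma conv_rec_level2:
  "conv h200 n - conv h200 (n - 1) = q powi n * conv h110 n"
  "conv h110 n - conv h110 (n - 1) = q powi n * conv h200 n + q powi n * conv h110 n - (q powi n)\<^sup>2 * conv h110 n"
proof -
  have *: "h200 = (\<lambda>n. op1 h110 n)" "h110 = (\<lambda>n. op1 h200 n + op1 h110 n - op2 h110 n)"
    using rec110 by (auto simp: h200_def op1_def)
  show "conv h200 n - conv h200 (n - 1) = q powi n * conv h110 n"
    by (subst conv_bdiff[symmetric], simp) (subst *(1), simp add: conv_rules)
  show "conv h110 n - conv h110 (n - 1) = q powi n * conv h200 n + q powi n * conv h110 n - (q powi n)\<^sup>2 * conv h110 n"
    by (subst conv_bdiff[symmetric], simp) (subst *(2), simp add: conv_rules)
qed

lemma iqf_of_nat: "iqf (int k) = inverse (qfact q k)"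
  by (simp add: iqf_def)

text \<open>1/((q)_j (q)_(r-j)) is [r, j] / (q)_r, and \<open>qsum_eq\<close> opens the sum over
  m_1: in this form \<open>s\<close> meets the summands of the theorem.\<close>

lemma s_eq_double_sum:
  "s a b (int r) = (\<Sum>j\<le>r. \<Sum>l\<le>r + j.
     q powi (int (r * r + j * j + l * l) - int (r * l) + a * int j + b * int l) / qfact q r * (gauss r j * gauss (r + j) l))"
proof -
  have "s a b (int r) = (\<Sum>j\<le>r. q powi (int r * int r + int j * int j + a * int j) * iqf (int j) * iqf (int r - int j)
      * qsum (nat (int r + int j)) (b - int r))"
    unfolding s_def by (rule sum.reindex_bij_witness[of _ int nat]) auto
  also have "\<dots> = (\<Sum>j\<le>r. \<Sum>l\<le>r + j.
     q powi (int (r * r + j * j + l * l) - int (r * l) + a * int j + b * int l) / qfact q r * (gauss r j * gauss (r + j) l))"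
  proof (rule sum.cong[OF refl])
    fix j assume "j \<in> {..r}"
    then have j: "j \<le> r" by simp
    have "iqf (int j) * iqf (int r - int j) = gauss r j / qfact q r"
      using j qfact_nonzero[of r] by (simp add: iqf_of_nat gauss_def field_simps flip: of_nat_diff)
    moreover have "q powi (int r * int r + int j * int j + a * int j) * q powi (int l * int l + (b - int r) * int l)
      = q powi (int (r * r + j * j + l * l) - int (r * l) + a * int j + b * int l)" for l
      unfolding powi_add[symmetric] by (rule arg_cong[where f = "\<lambda>x. q powi x"]) (simp add: algebra_simps)
    ultimately show "q powi (int r * int r + int j * int j + a * int j) * iqf (int j) * iqf (int r - int j)
      * qsum (nat (int r + int j)) (b - int r) = (\<Sum>l\<le>r + j.
     q powi (int (r * r + j * j + l * l) - int (r * l) + a * int j + b * int l) / qfact q r * (gauss r j * gauss (r + j) l))"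
      by (simp add: qsum_eq mult.assoc sum_distrib_left nat_int_add flip: mult.assoc[of _ _ "q powi _"])
         (intro sum.cong refl, simp add: mult_ac)
  qed
  finally show ?thesis .
qed

end


section \<open>Cylindric partitions with bounded parts\<close>

text \<open>\<open>card\<close> counts only when the sets of given size are finite; this is why
  \<open>gf_Un\<close> asks for sets of cylindric partitions of one profile.\<close>

definition gf :: "partition_triple set \<Rightarrow> rat fps" where
  "gf P = Abs_fps (\<lambda>N. of_nat (card {\<pi> \<in> P. cp_size \<pi> = N}))"

text \<open>The bound is an integer so that -1 is allowed; the set is then empty, and differences of
  consecutive bounds make sense from 0 on.\<close>

definition bounded_cp :: "nat \<times> nat \<times> nat \<Rightarrow> int \<Rightarrow> partition_triple set" where
  "bounded_cp c n = {(f0, f1, f2). (f0, f1, f2) \<in> cylindric_partitions c \<and>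
     (\<forall>j. int (f0 j) \<le> n \<and> int (f1 j) \<le> n \<and> int (f2 j) \<le> n)}"

definition bounded_gf :: "nat \<times> nat \<times> nat \<Rightarrow> int \<Rightarrow> rat fps" where
  "bounded_gf c n = gf (bounded_cp c n)"

lemma bounded_cp_iff:
  "(f0, f1, f2) \<in> bounded_cp c n \<longleftrightarrow> (f0, f1, f2) \<in> cylindric_partitions c \<and>
     (\<forall>j. int (f0 j) \<le> n \<and> int (f1 j) \<le> n \<and> int (f2 j) \<le> n)"
  by (simp add: bounded_cp_def)

lemma bounded_cp_subset: "bounded_cp c n \<subseteq> cylindric_partitions c"
  by (auto simp: bounded_cp_def)

lemma bounded_cp_is_partition:
  assumes "(f0, f1, f2) \<in> bounded_cp c n"
  shows "is_partition f0" "is_partition f1" "is_partition f2"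
  using assms by (cases c; simp add: bounded_cp_def cylindric_partitions_def)+

lemma gf_empty [simp]: "gf {} = 0"
  by (simp add: gf_def fps_eq_iff)

lemma gf_Un:
  assumes "P \<subseteq> cylindric_partitions c" "Q \<subseteq> cylindric_partitions c"
  shows "gf (P \<union> Q) = gf P + gf Q - gf (P \<inter> Q)"
proof (rule fps_ext)
  fix N
  have fin: "finite {\<pi> \<in> R. cp_size \<pi> = N}" if "R \<subseteq> cylindric_partitions c" for R
    by (rule finite_subset[OF _ finite_cylindric_partitions_of_size[of c N]]) (use that in auto)
  have "{\<pi> \<in> P \<union> Q. cp_size \<pi> = N} = {\<pi> \<in> P. cp_size \<pi> = N} \<union> {\<pi> \<in> Q. cp_size \<pi> = N}"
    "{\<pi> \<in> P \<inter> Q. cp_size \<pi> = N} = {\<pi> \<in> P. cp_size \<pi> = N} \<inter> {\<pi> \<in> Q. cp_size \<pi> = N}" by auto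
  then have "card {\<pi> \<in> P \<union> Q. cp_size \<pi> = N} + card {\<pi> \<in> P \<inter> Q. cp_size \<pi> = N}
    = card {\<pi> \<in> P. cp_size \<pi> = N} + card {\<pi> \<in> Q. cp_size \<pi> = N}"
    using card_Un_Int[OF fin[OF assms(1)] fin[OF assms(2)]] by simp
  then show "fps_nth (gf (P \<union> Q)) N = fps_nth (gf P + gf Q - gf (P \<inter> Q)) N"
    by (simp add: gf_def eq_diff_eq flip: of_nat_add)
qed

lemma gf_image:
  assumes "inj_on F P" "\<And>\<pi>. \<pi> \<in> P \<Longrightarrow> cp_size (F \<pi>) = t + cp_size \<pi>"
  shows "gf (F ` P) = fps_X ^ t * gf P"
proof (rule fps_ext)
  fix N
  show "fps_nth (gf (F ` P)) N = fps_nth (fps_X ^ t * gf P) N"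
  proof (cases "N < t")
    case True
    then have empty: "{\<pi> \<in> F ` P. cp_size \<pi> = N} = {}" using assms(2) by auto
    show ?thesis using True
      by (simp only: gf_def fps_nth_Abs_fps empty) (simp add: fps_X_power_mult_nth)
  next
    case False
    then have "{\<pi> \<in> F ` P. cp_size \<pi> = N} = F ` {\<pi> \<in> P. cp_size \<pi> = N - t}" 
      using assms(2) by auto
    moreover have "inj_on F {\<pi> \<in> P. cp_size \<pi> = N - t}"
      using assms(1) by (rule inj_on_subset) auto
    ultimately show ?thesis using False
      by (simp add: gf_def fps_X_power_mult_nth card_image)
  qed
qed

section \<open>Prepending a part to chosen rows\<close>

definition push :: "bool \<Rightarrow> nat \<Rightarrow> (nat \<Rightarrow> nat) \<Rightarrow> nat \<Rightarrow> nat" where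
  "push b m f = (if b then case_nat m f else f)"

lemma push_inj: "push b m f = push b m g \<longleftrightarrow> f = g"
  by (auto simp: push_def fun_eq_iff split: nat.splits)

lemma push_le_iff: "(\<forall>j. push b m f j \<le> m) \<longleftrightarrow> (\<forall>j. f j \<le> m)"
  by (auto simp: push_def split: nat.splits)

lemma push_tail: "(b \<longrightarrow> f 0 = m) \<longleftrightarrow> (\<exists>g. f = push b m g)"
proof (cases b)
  case True
  have "f = case_nat m (\<lambda>j. f (Suc j))" if "f 0 = m"
    using that by (auto simp: fun_eq_iff split: nat.splits)
  then show ?thesis using True by (auto simp: push_def)
qed (simp add: push_def)

lemma case_nat_support:
  "{j. case_nat m f j \<noteq> (0::nat)} \<subseteq> insert 0 (Suc ` {j. f j \<noteq> 0})"
proof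
  fix j assume "j \<in> {j. case_nat m f j \<noteq> 0}"
  then show "j \<in> insert 0 (Suc ` {j. f j \<noteq> 0})" by (cases j) auto
qed

lemma is_partition_push:
  assumes "\<forall>j. f j \<le> m"
  shows "is_partition (push b m f) \<longleftrightarrow> is_partition f"
proof (cases b)
  case True
  have "Suc ` {j. f j \<noteq> 0} \<subseteq> {j. case_nat m f j \<noteq> 0}"
    by auto
  with case_nat_support[of m f] have "finite {j. case_nat m f j \<noteq> 0} \<longleftrightarrow> finite {j. f j \<noteq> 0}"
    by (metis finite_imageD finite_imageI finite_insert finite_subset inj_Suc)
  moreover have "antimono (case_nat m f) \<longleftrightarrow> antimono f"
  proof
    assume "antimono (case_nat m f)"
    then have "f y \<le> f x" if "x \<le> y" for x y
      using that antimonoD[of "case_nat m f" "Suc x" "Suc y"] by simp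
    then show "antimono f" by (rule antimonoI)
  next
    assume "antimono f"
    have "case_nat m f y \<le> case_nat m f x" if "x \<le> y" for x y
      using that assms antimonoD[OF \<open>antimono f\<close>, of "x - 1" "y - 1"] by (cases x; cases y) auto
    then show "antimono (case_nat m f)" by (rule antimonoI)
  qed
  ultimately show ?thesis using True by (simp add: is_partition_def push_def)
qed (simp add: push_def)

lemma partition_size_push:
  assumes "is_partition f" "\<forall>j. f j \<le> m"
  shows "partition_size (push b m f) = of_bool b * m + partition_size f"
proof (cases b)
  case True
  have fin: "finite {j. f j \<noteq> 0}" using assms(1) by (simp add: is_partition_def)
  have "partition_size (case_nat m f) = (\<Sum>j\<in>insert 0 (Suc ` {j. f j \<noteq> 0}). case_nat m f j)"
    unfolding partition_size_def
    by (rule sum.mono_neutral_left) (use fin case_nat_support[of m f] in auto)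
  also have "\<dots> = m + partition_size f"
    using fin by (simp add: partition_size_def sum.reindex)
  finally show ?thesis using True by (simp add: push_def)
qed (simp add: push_def)

text \<open>A part prepended to f moves its entries one place on, so the offset grows by 1, and the
  new comparison at index 0 holds by the bound m. A part prepended to g lowers the offset by 1; with
  c > 0 that part is never compared with anything in the other row.\<close>

lemma push_interlace:
  assumes "\<forall>j. f j \<le> m" "\<forall>j. g j \<le> m" "b' \<longrightarrow> c > 0"
  shows "(\<forall>j. push b m f j \<ge> push b' m g (j + c)) \<longleftrightarrow> (\<forall>j. f j \<ge> g (j + (c + of_bool b - of_bool b')))"
proof -
  have split: "(\<forall>j::nat. P j) \<longleftrightarrow> P 0 \<and> (\<forall>j. P (Suc j))" for P
    by (metis nat.exhaust)
  obtain d where d: "b' \<longrightarrow> c = Suc d" using assms(3) by (cases c) auto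
  show ?thesis
    using assms d by (cases b; cases b') (simp_all add: push_def, (subst split; simp split: nat.splits)+)
qed

text \<open>The profile c(J), with J given by three flags. A row in J lowers its own entry and
  raises that of the next row; the subtraction is exact when the rows in J have positive
  entries.\<close>

definition pushed_profile :: "bool \<times> bool \<times> bool \<Rightarrow> nat \<times> nat \<times> nat \<Rightarrow> nat \<times> nat \<times> nat" where
  "pushed_profile = (\<lambda>(b0, b1, b2) (c0, c1, c2). (c0 + of_bool b2 - of_bool b0,
     c1 + of_bool b0 - of_bool b1, c2 + of_bool b1 - of_bool b2))"

text \<open>Rows outside J may start with m as well, so that intersections of these sets are again
  of this kind (\<open>topped_cp_Int\<close>).\<close>

definition topped_cp :: "bool \<times> bool \<times> bool \<Rightarrow> nat \<times> nat \<times> nat \<Rightarrow> nat \<Rightarrow> partition_triple set" where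
  "topped_cp = (\<lambda>(b0, b1, b2) c m. {(f0, f1, f2). (f0, f1, f2) \<in> bounded_cp c (int m) \<and>
     (b0 \<longrightarrow> f0 0 = m) \<and> (b1 \<longrightarrow> f1 0 = m) \<and> (b2 \<longrightarrow> f2 0 = m)})"

lemma gf_topped_cp:
  assumes "b0 \<longrightarrow> c0 > 0" "b1 \<longrightarrow> c1 > 0" "b2 \<longrightarrow> c2 > 0"
  shows "gf (topped_cp (b0, b1, b2) (c0, c1, c2) m) = fps_X ^ ((of_bool b0 + of_bool b1 + of_bool b2) * m) *
    bounded_gf (pushed_profile (b0, b1, b2) (c0, c1, c2)) (int m)"
proof -
  let ?F = "\<lambda>(g0, g1, g2). (push b0 m g0, push b1 m g1, push b2 m g2)"
  let ?c = "pushed_profile (b0, b1, b2) (c0, c1, c2)"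
  have iff: "?F (g0, g1, g2) \<in> bounded_cp (c0, c1, c2) (int m) \<longleftrightarrow> (g0, g1, g2) \<in> bounded_cp ?c (int m)" for g0 g1 g2
  \<comment> \<open>The lemmas on \<open>push\<close> presuppose rows bounded by m; if some row
    exceeds m, both memberships fail.\<close>
  proof (cases "(\<forall>j. g0 j \<le> m) \<and> (\<forall>j. g1 j \<le> m) \<and> (\<forall>j. g2 j \<le> m)")
    case True
    then show ?thesis
      using push_le_iff[of b0 m g0] push_le_iff[of b1 m g1] push_le_iff[of b2 m g2]
      by (simp add: bounded_cp_def cylindric_partitions_def pushed_profile_def is_partition_push push_interlace assms)
  next
    case False
    then show ?thesis
      using push_le_iff[of b0 m g0] push_le_iff[of b1 m g1] push_le_iff[of b2 m g2]
      by (simp add: bounded_cp_def) blast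
  qed
  have "topped_cp (b0, b1, b2) (c0, c1, c2) m = ?F ` bounded_cp ?c (int m)"
  proof (intro set_eqI iffI)
    fix \<pi> assume "\<pi> \<in> topped_cp (b0, b1, b2) (c0, c1, c2) m"
    then obtain f0 f1 f2 where \<pi>: "\<pi> = (f0, f1, f2)" "(f0, f1, f2) \<in> bounded_cp (c0, c1, c2) (int m)"
      "b0 \<longrightarrow> f0 0 = m" "b1 \<longrightarrow> f1 0 = m" "b2 \<longrightarrow> f2 0 = m"
      by (auto simp: topped_cp_def)
    then obtain g0 g1 g2 where "\<pi> = ?F (g0, g1, g2)"
      unfolding push_tail by auto
    then show "\<pi> \<in> ?F ` bounded_cp ?c (int m)"
      using iff \<pi> by (intro image_eqI[of _ _ "(g0, g1, g2)"]) auto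
  next
    fix \<pi> assume "\<pi> \<in> ?F ` bounded_cp ?c (int m)"
    then obtain g0 g1 g2 where *: "\<pi> = ?F (g0, g1, g2)" "(g0, g1, g2) \<in> bounded_cp ?c (int m)"
      by auto
    have "b0 \<longrightarrow> push b0 m g0 0 = m" "b1 \<longrightarrow> push b1 m g1 0 = m" "b2 \<longrightarrow> push b2 m g2 0 = m"
      unfolding push_tail by blast+
    then show "\<pi> \<in> topped_cp (b0, b1, b2) (c0, c1, c2) m"
      using iff[of g0 g1 g2] * by (auto simp: topped_cp_def)
  qed
  moreover have "gf (?F ` bounded_cp ?c (int m)) = fps_X ^ ((of_bool b0 + of_bool b1 + of_bool b2) * m) * gf (bounded_cp ?c (int m))"
  proof (rule gf_image)
    show "inj_on ?F (bounded_cp ?c (int m))"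
      by (auto simp: inj_on_def push_inj)
    fix \<pi> assume "\<pi> \<in> bounded_cp ?c (int m)"
    then obtain g0 g1 g2 where \<pi>: "\<pi> = (g0, g1, g2)" "(g0, g1, g2) \<in> bounded_cp ?c (int m)"
      by (cases \<pi>) auto
    then have "\<forall>j. g0 j \<le> m" "\<forall>j. g1 j \<le> m" "\<forall>j. g2 j \<le> m"
      by (simp_all add: bounded_cp_def)
    with bounded_cp_is_partition[OF \<pi>(2)] show "cp_size (?F \<pi>) = (of_bool b0 + of_bool b1 + of_bool b2) * m + cp_size \<pi>"
      by (simp add: \<pi> cp_size_def partition_size_push algebra_simps)
  qed
  ultimately show ?thesis by (simp add: bounded_gf_def)
qed

lemma topped_cp_bounded: "topped_cp b c m \<subseteq> bounded_cp c (int m)"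
  by (cases b) (auto simp: topped_cp_def)

lemma topped_cp_subset: "topped_cp b c m \<subseteq> cylindric_partitions c"
  using topped_cp_bounded bounded_cp_subset by (rule subset_trans)

lemma topped_cp_Int: "topped_cp (a0, a1, a2) c m \<inter> topped_cp (b0, b1, b2) c m = topped_cp (a0 \<or> b0, a1 \<or> b1, a2 \<or> b2) c m"
  by (auto simp: topped_cp_def)

lemma antimono_le_0: "antimono (f :: nat \<Rightarrow> nat) \<Longrightarrow> f j \<le> f 0"
  by (auto simp: antimono_def)

lemma bounded_cp_mono: "n \<le> n' \<Longrightarrow> bounded_cp c n \<subseteq> bounded_cp c n'"
proof -
  assume "n \<le> n'"
  then have "(f0, f1, f2) \<in> bounded_cp c n'" if "(f0, f1, f2) \<in> bounded_cp c n" for f0 f1 f2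
    using that by (simp add: bounded_cp_def) (meson order_trans)
  then show ?thesis by (intro subrelI subsetI) auto
qed

lemma bounded_cp_heads:
  assumes "(f0, f1, f2) \<in> bounded_cp (c0, c1, c2) (int m)"
  shows "f0 0 \<le> m" "f1 0 \<le> m" "f2 0 \<le> m" "c1 = 0 \<Longrightarrow> f1 0 \<le> f0 0" "c2 = 0 \<Longrightarrow> f2 0 \<le> f1 0"
proof -
  have "int (f0 0) \<le> int m" "int (f1 0) \<le> int m" "int (f2 0) \<le> int m" "f1 (0 + c1) \<le> f0 0" "f2 (0 + c2) \<le> f1 0"
    using assms unfolding bounded_cp_def cylindric_partitions_def by blast+
  then show "f0 0 \<le> m" "f1 0 \<le> m" "f2 0 \<le> m" "c1 = 0 \<Longrightarrow> f1 0 \<le> f0 0" "c2 = 0 \<Longrightarrow> f2 0 \<le> f1 0"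
    by simp_all
qed

text \<open>With c_i = 0 row i starts no higher than row i - 1, so a first part m in row i forces
  one in row i - 1. This is why rows with c_i = 0 drop out of J.\<close>

lemma topped_cp_inherit:
  "topped_cp (False, True, False) (c0, 0, c2) m \<subseteq> topped_cp (True, False, False) (c0, 0, c2) m"
  "topped_cp (False, False, True) (c0, c1, 0) m \<subseteq> topped_cp (False, True, False) (c0, c1, 0) m"
proof safe
  fix f0 f1 f2
  show "(f0, f1, f2) \<in> topped_cp (True, False, False) (c0, 0, c2) m"
    if "(f0, f1, f2) \<in> topped_cp (False, True, False) (c0, 0, c2) m"
    using that bounded_cp_heads[of f0 f1 f2 c0 0 c2 m] by (auto simp: topped_cp_def)
  show "(f0, f1, f2) \<in> topped_cp (False, True, False) (c0, c1, 0) m"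
    if "(f0, f1, f2) \<in> topped_cp (False, False, True) (c0, c1, 0) m"
    using that bounded_cp_heads[of f0 f1 f2 c0 c1 0 m] by (auto simp: topped_cp_def)
qed

section \<open>Inclusion-exclusion over the rows that start with the bound\<close>

lemma bounded_cp_split:
  "bounded_cp c (int m) = bounded_cp c (int m - 1) \<union>
     (topped_cp (True, False, False) c m \<union> topped_cp (False, True, False) c m \<union> topped_cp (False, False, True) c m)"
  (is "?l = ?r")
proof (intro set_eqI iffI)
  fix \<pi> assume *: "\<pi> \<in> ?l"
  obtain f0 f1 f2 where \<pi>: "\<pi> = (f0, f1, f2)" by (cases \<pi>)
  have am: "antimono f0" "antimono f1" "antimono f2"
    using bounded_cp_is_partition[of f0 f1 f2] * by (auto simp: \<pi> is_partition_def)
  have "int (f0 0) \<le> int m \<and> int (f1 0) \<le> int m \<and> int (f2 0) \<le> int m"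
    using * unfolding \<pi> bounded_cp_iff by blast
  then have le: "f0 0 \<le> m" "f1 0 \<le> m" "f2 0 \<le> m" by simp_all
  show "\<pi> \<in> ?r"
  proof (cases "f0 0 = m \<or> f1 0 = m \<or> f2 0 = m")
    case False
    then have lt: "f0 0 < m" "f1 0 < m" "f2 0 < m" using le by auto
    have "int (f0 j) \<le> int m - 1 \<and> int (f1 j) \<le> int m - 1 \<and> int (f2 j) \<le> int m - 1" for j
      using lt am[THEN antimono_le_0, of j] by linarith
    then have "\<pi> \<in> bounded_cp c (int m - 1)"
      using * unfolding \<pi> bounded_cp_iff by blast
    then show ?thesis by blast
  qed (use * in \<open>auto simp: \<pi> topped_cp_def\<close>)
next
  fix \<pi> assume "\<pi> \<in> ?r"
  moreover have "bounded_cp c (int m - 1) \<subseteq> bounded_cp c (int m)"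
    by (rule bounded_cp_mono) simp
  ultimately show "\<pi> \<in> ?l"
    using topped_cp_bounded by (elim UnE) (erule subsetD[rotated], assumption)+
qed

lemma bounded_topped_disjoint: 
  assumes "b0 \<or> b1 \<or> b2"
  shows "bounded_cp c (int m - 1) \<inter> topped_cp (b0, b1, b2) c m = {}"
proof -
  have False if "(f0, f1, f2) \<in> bounded_cp c (int m - 1)" "(f0, f1, f2) \<in> topped_cp (b0, b1, b2) c m" for f0 f1 f2
  proof -
    have "int (f0 0) \<le> int m - 1" "int (f1 0) \<le> int m - 1" "int (f2 0) \<le> int m - 1"
      using that(1) unfolding bounded_cp_iff by blast+
    with that(2) show False using assms by (auto simp: topped_cp_def)
  qed
  then show ?thesis by auto
qed

text \<open>One lemma for each number of positive entries, with the zeros at the end of the profile;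
  rotation brings the other profiles into this form. Here only J = {0} is left.\<close>

lemma bounded_gf_rec_1:
  assumes "c0 > 0"
  shows "bounded_gf (c0, 0, 0) (int m) - bounded_gf (c0, 0, 0) (int m - 1)
     = fps_X ^ m * bounded_gf (c0 - 1, 1, 0) (int m)"
proof -
  let ?c = "(c0, 0, 0) :: nat \<times> nat \<times> nat"
  have "bounded_cp ?c (int m) = bounded_cp ?c (int m - 1) \<union> topped_cp (True, False, False) ?c m"
    unfolding bounded_cp_split[of ?c m]
    by (simp only: Un_assoc Un_absorb2[OF topped_cp_inherit(1)]
        Un_absorb2[OF subset_trans[OF topped_cp_inherit(2) topped_cp_inherit(1)]]
        Un_absorb2[OF topped_cp_inherit(2)])
  then have "bounded_gf ?c (int m) = bounded_gf ?c (int m - 1) + gf (topped_cp (True, False, False) ?c m)"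
    by (simp add: bounded_gf_def gf_Un[OF bounded_cp_subset topped_cp_subset] bounded_topped_disjoint)
  then show ?thesis using assms by (simp add: gf_topped_cp pushed_profile_def)
qed

lemma bounded_gf_rec_2:
  assumes "c0 > 0" "c1 > 0"
  shows "bounded_gf (c0, c1, 0) (int m) - bounded_gf (c0, c1, 0) (int m - 1)
     = fps_X ^ m * bounded_gf (c0 - 1, c1 + 1, 0) (int m) + fps_X ^ m * bounded_gf (c0, c1 - 1, 1) (int m)
       - fps_X ^ (2 * m) * bounded_gf (c0 - 1, c1, 1) (int m)"
proof -
  let ?c = "(c0, c1, 0) :: nat \<times> nat \<times> nat"
  let ?A = "topped_cp (True, False, False) ?c m" and ?B = "topped_cp (False, True, False) ?c m"
  have "bounded_cp ?c (int m) = bounded_cp ?c (int m - 1) \<union> (?A \<union> ?B)"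
    unfolding bounded_cp_split[of ?c m] by (simp only: Un_assoc Un_absorb2[OF topped_cp_inherit(2)])
  moreover have "bounded_cp ?c (int m - 1) \<inter> (?A \<union> ?B) = {}"
    by (simp add: Int_Un_distrib bounded_topped_disjoint)
  moreover have sub: "?A \<union> ?B \<subseteq> cylindric_partitions ?c"
    using topped_cp_subset by auto
  ultimately have "bounded_gf ?c (int m) = bounded_gf ?c (int m - 1) + gf (?A \<union> ?B)"
    by (simp add: bounded_gf_def gf_Un[OF bounded_cp_subset sub])
  also have "gf (?A \<union> ?B) = gf ?A + gf ?B - gf (?A \<inter> ?B)"
    by (rule gf_Un[OF topped_cp_subset topped_cp_subset])
  finally have "bounded_gf ?c (int m) - bounded_gf ?c (int m - 1) = gf ?A + gf ?B - gf (?A \<inter> ?B)"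
    by simp
  also have "gf ?A = fps_X ^ m * bounded_gf (c0 - 1, c1 + 1, 0) (int m)"
    using assms by (subst gf_topped_cp) (auto simp: pushed_profile_def)
  also have "gf ?B = fps_X ^ m * bounded_gf (c0, c1 - 1, 1) (int m)"
    using assms by (subst gf_topped_cp) (auto simp: pushed_profile_def)
  also have "gf (?A \<inter> ?B) = fps_X ^ (2 * m) * bounded_gf (c0 - 1, c1, 1) (int m)"
    unfolding topped_cp_Int using assms by (subst gf_topped_cp) (auto simp: pushed_profile_def mult_2)
  finally show ?thesis .
qed

lemma bounded_gf_rec_3:
  assumes "c0 > 0" "c1 > 0" "c2 > 0"
  shows "bounded_gf (c0, c1, c2) (int m) - bounded_gf (c0, c1, c2) (int m - 1)
     = fps_X ^ m * (bounded_gf (c0 - 1, c1 + 1, c2) (int m) + bounded_gf (c0, c1 - 1, c2 + 1) (int m) + bounded_gf (c0 + 1, c1, c2 - 1) (int m))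
       - fps_X ^ (2 * m) * (bounded_gf (c0 - 1, c1, c2 + 1) (int m) + bounded_gf (c0 + 1, c1 - 1, c2) (int m) + bounded_gf (c0, c1 + 1, c2 - 1) (int m))
       + fps_X ^ (3 * m) * bounded_gf (c0, c1, c2) (int m)"
proof -
  let ?c = "(c0, c1, c2)"
  let ?A = "topped_cp (True, False, False) ?c m" and ?B = "topped_cp (False, True, False) ?c m"
    and ?C = "topped_cp (False, False, True) ?c m"
  have "bounded_cp ?c (int m - 1) \<inter> (?A \<union> ?B \<union> ?C) = {}"
    by (simp add: Int_Un_distrib bounded_topped_disjoint)
  moreover have sub: "?A \<union> ?B \<subseteq> cylindric_partitions ?c" "?A \<union> ?B \<union> ?C \<subseteq> cylindric_partitions ?c" 
     "?A \<inter> ?C \<subseteq> cylindric_partitions ?c" "?B \<inter> ?C \<subseteq> cylindric_partitions ?c"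
    by (simp_all add: topped_cp_subset le_infI1)
  ultimately have "bounded_gf ?c (int m) = bounded_gf ?c (int m - 1) + gf (?A \<union> ?B \<union> ?C)"
    using bounded_cp_split[of ?c m]
    by (simp add: bounded_gf_def gf_Un[OF bounded_cp_subset sub(2)])
  also have "gf (?A \<union> ?B \<union> ?C) = gf (?A \<union> ?B) + gf ?C - gf ((?A \<inter> ?C) \<union> (?B \<inter> ?C))"
    by (simp add: gf_Un[OF sub(1) topped_cp_subset] Int_Un_distrib2)
  also have "\<dots> = gf ?A + gf ?B - gf (?A \<inter> ?B) + gf ?C - (gf (?A \<inter> ?C) + gf (?B \<inter> ?C) - gf ((?A \<inter> ?C) \<inter> (?B \<inter> ?C)))"
    by (simp only: gf_Un[OF topped_cp_subset topped_cp_subset] gf_Un[OF sub(3,4)])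
  finally have "bounded_gf ?c (int m) - bounded_gf ?c (int m - 1)
    = (gf ?A + gf ?B + gf ?C) - (gf (?A \<inter> ?C) + gf (?A \<inter> ?B) + gf (?B \<inter> ?C)) + gf ((?A \<inter> ?C) \<inter> (?B \<inter> ?C))"
    by simp
  also have "gf ?A = fps_X ^ m * bounded_gf (c0 - 1, c1 + 1, c2) (int m)"
    using assms by (subst gf_topped_cp) (auto simp: pushed_profile_def)
  also have "gf ?B = fps_X ^ m * bounded_gf (c0, c1 - 1, c2 + 1) (int m)"
    using assms by (subst gf_topped_cp) (auto simp: pushed_profile_def)
  also have "gf ?C = fps_X ^ m * bounded_gf (c0 + 1, c1, c2 - 1) (int m)"
    using assms by (subst gf_topped_cp) (auto simp: pushed_profile_def)
  also have "gf (?A \<inter> ?C) = fps_X ^ (2 * m) * bounded_gf (c0, c1 + 1, c2 - 1) (int m)"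
    unfolding topped_cp_Int using assms by (subst gf_topped_cp) (auto simp: pushed_profile_def mult_2)
  also have "gf (?A \<inter> ?B) = fps_X ^ (2 * m) * bounded_gf (c0 - 1, c1, c2 + 1) (int m)"
    unfolding topped_cp_Int using assms by (subst gf_topped_cp) (auto simp: pushed_profile_def mult_2)
  also have "gf (?B \<inter> ?C) = fps_X ^ (2 * m) * bounded_gf (c0 + 1, c1 - 1, c2) (int m)"
    unfolding topped_cp_Int using assms by (subst gf_topped_cp) (auto simp: pushed_profile_def mult_2)
  also have "gf ((?A \<inter> ?C) \<inter> (?B \<inter> ?C)) = fps_X ^ (3 * m) * bounded_gf (c0, c1, c2) (int m)"
    unfolding topped_cp_Int using assms by (subst gf_topped_cp) (auto simp: pushed_profile_def)
  finally show ?thesis by (simp only: distrib_left add.assoc add.left_commute add.commute)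
qed

lemma bounded_gf_rotate: "bounded_gf (c0, c1, c2) n = bounded_gf (c1, c2, c0) n"
proof -
  let ?F = "\<lambda>(f0, f1, f2). (f1, f2, f0) :: partition_triple"
  have iff: "(f1, f2, f0) \<in> bounded_cp (c1, c2, c0) n \<longleftrightarrow> (f0, f1, f2) \<in> bounded_cp (c0, c1, c2) n" for f0 f1 f2
    unfolding bounded_cp_def cylindric_partitions_def mem_Collect_eq prod.case by blast
  have "bounded_cp (c1, c2, c0) n = ?F ` bounded_cp (c0, c1, c2) n"
  proof (intro set_eqI iffI)
    fix \<pi> assume "\<pi> \<in> bounded_cp (c1, c2, c0) n"
    then obtain f1 f2 f0 where "\<pi> = (f1, f2, f0)" "(f1, f2, f0) \<in> bounded_cp (c1, c2, c0) n"
      by (cases \<pi>) auto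
    then show "\<pi> \<in> ?F ` bounded_cp (c0, c1, c2) n"
      by (intro image_eqI[of _ _ "(f0, f1, f2)"]) (simp_all add: iff)
  qed (auto simp: iff)
  moreover have "gf (?F ` bounded_cp (c0, c1, c2) n) = fps_X ^ 0 * gf (bounded_cp (c0, c1, c2) n)"
    by (rule gf_image) (auto simp: inj_on_def cp_size_def)
  ultimately show ?thesis by (simp add: bounded_gf_def)
qed

lemma bounded_gf_neg: "n < 0 \<Longrightarrow> bounded_gf c n = 0"
proof -
  assume "n < 0"
  then have "\<not> int k \<le> n" for k by simp
  then have "bounded_cp c n = {}"
    by (simp add: bounded_cp_def)
  then show ?thesis by (simp add: bounded_gf_def)
qed

lemma bounded_gf_0: "bounded_gf c 0 = 1"
proof -
  have "(f0, f1, f2) \<in> bounded_cp c 0 \<longleftrightarrow> (f0, f1, f2) = (\<lambda>_. 0, \<lambda>_. 0, \<lambda>_. 0)" for f0 f1 f2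
  proof
    assume "(f0, f1, f2) \<in> bounded_cp c 0"
    then show "(f0, f1, f2) = (\<lambda>_. 0, \<lambda>_. 0, \<lambda>_. 0)"
      by (simp add: bounded_cp_def fun_eq_iff)
  next
    assume "(f0, f1, f2) = (\<lambda>_. 0, \<lambda>_. 0, \<lambda>_. 0)"
    then show "(f0, f1, f2) \<in> bounded_cp c 0"
      by (cases c) (simp add: bounded_cp_def cylindric_partitions_def is_partition_def antimono_def)
  qed
  then have "bounded_cp c 0 = {(\<lambda>_. 0, \<lambda>_. 0, \<lambda>_. 0)}" by auto
  then have "fps_nth (bounded_gf c 0) N = fps_nth 1 N" for N
    by (simp add: bounded_gf_def gf_def cp_size_def partition_size_def Collect_conv_if)
  then show ?thesis by (rule fps_ext)
qed

text \<open>The ranges of the rows are finite, so the \<open>Max\<close> in \<open>cp_max\<close> is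
  a genuine maximum; for negative n both sides are false.\<close>

lemma cp_max_le_iff:
  assumes "\<pi> \<in> cylindric_partitions c"
  shows "int (cp_max \<pi>) \<le> n \<longleftrightarrow> \<pi> \<in> bounded_cp c n"
proof -
  obtain f0 f1 f2 where \<pi>: "\<pi> = (f0, f1, f2)" by (cases \<pi>)
  have "finite (range f)" if "is_partition f" for f
    by (rule finite_subset[of _ "{..partition_size f}"]) (use is_partition_bounds[OF that] in auto)
  then have "finite (range f0 \<union> range f1 \<union> range f2)"
    using assms by (auto simp: \<pi> cylindric_partitions_def split: prod.splits)
  then have max: "cp_max \<pi> \<le> k \<longleftrightarrow> (\<forall>j. f0 j \<le> k \<and> f1 j \<le> k \<and> f2 j \<le> k)" for k
    unfolding \<pi> cp_max_def prod.case by (subst Max_le_iff) auto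
  have mem: "\<pi> \<in> bounded_cp c n \<longleftrightarrow> (\<forall>j. int (f0 j) \<le> n \<and> int (f1 j) \<le> n \<and> int (f2 j) \<le> n)"
    using assms unfolding \<pi> bounded_cp_iff by blast
  show ?thesis
  proof (cases "n < 0")
    case True
    then have "\<not> int k \<le> n" for k by simp
    then show ?thesis unfolding mem by blast
  next
    case False
    then have "int k \<le> n \<longleftrightarrow> k \<le> nat n" for k by (simp add: le_nat_iff)
    then show ?thesis unfolding mem by (simp only: max)
  qed
qed

text \<open>The partitions with maximum exactly n are those bounded by n but not by n - 1: G_c is 1
  - z times the generating function of the bounded counts.\<close>

lemma cp_series_nth:
  "fps_nth (fps_nth (cp_series c) N) n = fps_nth (bounded_gf c (int n) - bounded_gf c (int n - 1)) N"
proof -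
  let ?f = "\<lambda>\<pi>. var_z ^ cp_max \<pi> * var_q ^ cp_size \<pi>"
  let ?S = "{\<pi> \<in> cylindric_partitions c. cp_size \<pi> = N}"
  let ?B = "\<lambda>k. {\<pi> \<in> bounded_cp c k. cp_size \<pi> = N}"
  have nth: "fps_nth (?f \<pi>) M = (if M = cp_size \<pi> then fps_X ^ cp_max \<pi> else 0)" for \<pi> M
    by (simp add: fps_X_power_mult_right_nth fps_const_power)
  have eq: "{\<pi> \<in> cylindric_partitions c. fps_nth (?f \<pi>) M \<noteq> 0} = {\<pi> \<in> cylindric_partitions c. cp_size \<pi> = M}" for M
    by (auto simp: nth)
  have "\<pi> \<in> bounded_cp c k \<longleftrightarrow> \<pi> \<in> cylindric_partitions c \<and> int (cp_max \<pi>) \<le> k" for \<pi> k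
    using cp_max_le_iff[of \<pi> c k] bounded_cp_subset[of c k] by (meson subsetD)
  then have S_eq: "{\<pi> \<in> ?S. cp_max \<pi> = n} = ?B (int n) - ?B (int n - 1)"
    by auto
  have fin: "finite (?B k)" for k
    by (rule finite_subset[OF _ finite_cylindric_partitions_of_size[of c N]]) (use bounded_cp_subset[of c k] in auto)
  have sub: "?B (int n - 1) \<subseteq> ?B (int n)"
    using bounded_cp_mono[of "int n - 1" "int n" c] by auto
  have "(?f has_sum Abs_fps (\<lambda>M. \<Sum>\<pi> | \<pi> \<in> cylindric_partitions c \<and> fps_nth (?f \<pi>) M \<noteq> 0. fps_nth (?f \<pi>) M)) (cylindric_partitions c)"
    by (intro has_sum_fpsI) (simp_all only: eq finite_cylindric_partitions_of_size fps_nth_Abs_fps)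
  then have "fps_nth (cp_series c) N = (\<Sum>\<pi> | \<pi> \<in> cylindric_partitions c \<and> fps_nth (?f \<pi>) N \<noteq> 0. fps_nth (?f \<pi>) N)"
    by (simp only: cp_series_def infsumI fps_nth_Abs_fps)
  also have "\<dots> = (\<Sum>\<pi>\<in>?S. fps_X ^ cp_max \<pi>)"
    unfolding eq by (intro sum.cong) (auto simp: nth)
  finally have "fps_nth (fps_nth (cp_series c) N) n = (\<Sum>\<pi>\<in>?S. if cp_max \<pi> = n then 1 else 0)"
    by (simp add: fps_sum_nth eq_commute)
  also have "\<dots> = of_nat (card {\<pi> \<in> ?S. cp_max \<pi> = n})"
    using finite_cylindric_partitions_of_size[of c N] by (simp flip: sum.inter_filter)
  also have "\<dots> = of_nat (card (?B (int n))) - of_nat (card (?B (int n - 1)))"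
    unfolding S_eq using fin sub by (simp add: card_Diff_subset of_nat_diff card_mono)
  finally show ?thesis by (simp add: bounded_gf_def gf_def)
qed


section \<open>Solving the system of recurrences\<close>

text \<open>Laurent series provide the negative powers of \<open>q\<close> in the contiguous relations. The deleted rule would
  turn powers of \<open>q\<close> into shifts.\<close>

declare fls_X_power_int [simp del]

interpretation flsq: q_field "fls_X :: rat fls"
proof
  fix k :: nat
  assume "k > 0"
  then have "fls_nth (fls_X ^ k :: rat fls) 0 \<noteq> fls_nth 1 0" by simp
  then show "(fls_X ^ k :: rat fls) \<noteq> 1" by metis
qed simp

lemma fps_to_fls_inverse:
  "fps_nth f 0 \<noteq> 0 \<Longrightarrow> fps_to_fls (inverse f) = inverse (fps_to_fls f)" for f :: "rat fps"
  by (simp add: fls_inverse_fps_to_fls)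

lemma fps_to_fls_divide:
  "fps_nth g 0 \<noteq> 0 \<Longrightarrow> fps_to_fls (f / g) = fps_to_fls f / fps_to_fls g" for f g :: "rat fps"
  by (simp add: fps_divide_unit fls_times_fps_to_fls fps_to_fls_inverse divide_inverse)

lemma fps_to_fls_sum: "fps_to_fls (sum f A) = (\<Sum>x\<in>A. fps_to_fls (f x))"
  by (induction A rule: infinite_finite_induct) auto

lemma qfact_fps_nth_0: "fps_nth (qfact fps_X n) 0 = 1" for n :: nat
  by (induction n) (simp_all add: qfact_Suc)

lemma fps_to_fls_qfact: "fps_to_fls (qfact fps_X n) = qfact fls_X n"
  by (induction n) (simp_all add: qfact_Suc fls_times_fps_to_fls fps_to_fls_power)

lemma fls_X_power_mult_nth: "fls_nth (fls_X ^ m * f) k = fls_nth f (k - int m)" for f :: "rat fls"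
  by (simp add: fls_X_power_times_conv_shift)

text \<open>A Laurent series has finitely many negative powers, so all members of the finite family
  vanish below a common degree K, and \<open>step\<close> pushes this bound upwards one coefficient
  at a time. This is the uniqueness of the solution.\<close>

lemma fls_system_zero:
  fixes \<delta> :: "'i \<Rightarrow> rat fls"
  assumes "finite C" "c \<in> C"
    and step: "\<And>c k. c \<in> C \<Longrightarrow> (\<And>c' k'. c' \<in> C \<Longrightarrow> k' < k \<Longrightarrow> fls_nth (\<delta> c') k' = 0) \<Longrightarrow> fls_nth (\<delta> c) k = 0"
  shows "\<delta> c = 0"
proof -
  define K where "K = Min (fls_subdegree ` \<delta> ` C)"
  have K: "K \<le> fls_subdegree (\<delta> c)" if "c \<in> C" for c
    unfolding K_def using assms(1) that by (intro Min_le) auto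
  have *: "\<forall>c\<in>C. \<forall>k < K + int n. fls_nth (\<delta> c) k = 0" for n
  proof (induction n)
    case 0
    show ?case using K by (auto intro!: fls_eq0_below_subdegree dest: order_less_le_trans)
  next
    case (Suc n)
    show ?case
    proof (intro ballI allI impI)
      fix c k assume c: "c \<in> C" and k: "k < K + int (Suc n)"
      have "fls_nth (\<delta> c') k' = 0" if "c' \<in> C" "k' < k" for c' k'
        using Suc.IH that k by simp
      with c show "fls_nth (\<delta> c) k = 0" by (rule step)
    qed
  qed
  have "fls_nth (\<delta> c) k = 0" for k
  proof -
    have "k < K + int (nat (k - K + 1))" by simp
    with * assms(2) show ?thesis by blast
  qed
  then show ?thesis by (simp add: fls_eq_iff)
qed

definition h5 :: "nat \<times> nat \<times> nat \<Rightarrow> int \<Rightarrow> rat fls" where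
  "h5 c = (if c = (5, 0, 0) then flsq.h500 else if c = (4, 1, 0) then flsq.h410
     else if c = (4, 0, 1) then flsq.h401 else if c = (3, 2, 0) then flsq.h320
     else if c = (3, 0, 2) then flsq.h302 else if c = (3, 1, 1) then flsq.h311 else flsq.h221)"

lemma bounded_gf_level5:
  fixes m :: nat
  defines "A \<equiv> \<lambda>c. bounded_gf c (int m)"
  shows "bounded_gf (5, 0, 0) (int m) - bounded_gf (5, 0, 0) (int m - 1) = fps_X ^ m * A (4, 1, 0)"
    "bounded_gf (4, 1, 0) (int m) - bounded_gf (4, 1, 0) (int m - 1)
      = fps_X ^ m * A (3, 2, 0) + fps_X ^ m * A (4, 0, 1) - fps_X ^ (2 * m) * A (3, 1, 1)"
    "bounded_gf (4, 0, 1) (int m) - bounded_gf (4, 0, 1) (int m - 1)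
      = fps_X ^ m * A (5, 0, 0) + fps_X ^ m * A (3, 1, 1) - fps_X ^ (2 * m) * A (4, 1, 0)"
    "bounded_gf (3, 2, 0) (int m) - bounded_gf (3, 2, 0) (int m - 1)
      = fps_X ^ m * A (3, 0, 2) + fps_X ^ m * A (3, 1, 1) - fps_X ^ (2 * m) * A (2, 2, 1)"
    "bounded_gf (3, 0, 2) (int m) - bounded_gf (3, 0, 2) (int m - 1)
      = fps_X ^ m * A (4, 0, 1) + fps_X ^ m * A (2, 2, 1) - fps_X ^ (2 * m) * A (3, 1, 1)"
    "bounded_gf (3, 1, 1) (int m) - bounded_gf (3, 1, 1) (int m - 1)
      = fps_X ^ m * (A (2, 2, 1) + A (3, 0, 2) + A (4, 1, 0)) - fps_X ^ (2 * m) * (A (2, 2, 1) + A (4, 0, 1) + A (3, 2, 0))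
       + fps_X ^ (3 * m) * A (3, 1, 1)"
    "bounded_gf (2, 2, 1) (int m) - bounded_gf (2, 2, 1) (int m - 1)
      = fps_X ^ m * (A (3, 1, 1) + A (2, 2, 1) + A (3, 2, 0)) - fps_X ^ (2 * m) * (A (2, 2, 1) + A (3, 1, 1) + A (3, 0, 2))
       + fps_X ^ (3 * m) * A (2, 2, 1)"
proof -
  note rot = bounded_gf_rotate
  have r: "bounded_gf (0, 5, 0) n = bounded_gf (5, 0, 0) n" "bounded_gf (0, 4, 1) n = bounded_gf (4, 1, 0) n"
    "bounded_gf (1, 3, 1) n = bounded_gf (3, 1, 1) n" "bounded_gf (1, 4, 0) n = bounded_gf (4, 0, 1) n"
    "bounded_gf (2, 3, 0) n = bounded_gf (3, 0, 2) n"
    "bounded_gf (1, 2, 2) n = bounded_gf (2, 2, 1) n" "bounded_gf (2, 1, 2) n = bounded_gf (2, 2, 1) n" for n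
    by (rule rot rot[THEN trans, OF rot])+
  show "bounded_gf (5, 0, 0) (int m) - bounded_gf (5, 0, 0) (int m - 1) = fps_X ^ m * A (4, 1, 0)"
    using bounded_gf_rec_1[of 5 m] by (simp add: A_def)
  show "bounded_gf (4, 1, 0) (int m) - bounded_gf (4, 1, 0) (int m - 1)
      = fps_X ^ m * A (3, 2, 0) + fps_X ^ m * A (4, 0, 1) - fps_X ^ (2 * m) * A (3, 1, 1)"
    using bounded_gf_rec_2[of 4 1 m] by (simp add: A_def numeral_eq_Suc)
  show "bounded_gf (4, 0, 1) (int m) - bounded_gf (4, 0, 1) (int m - 1)
      = fps_X ^ m * A (5, 0, 0) + fps_X ^ m * A (3, 1, 1) - fps_X ^ (2 * m) * A (4, 1, 0)"
    using bounded_gf_rec_2[of 1 4 m] by (simp add: A_def r[unfolded One_nat_def])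
  show "bounded_gf (3, 2, 0) (int m) - bounded_gf (3, 2, 0) (int m - 1)
      = fps_X ^ m * A (3, 0, 2) + fps_X ^ m * A (3, 1, 1) - fps_X ^ (2 * m) * A (2, 2, 1)"
    using bounded_gf_rec_2[of 3 2 m] by (simp add: A_def r[unfolded One_nat_def])
  show "bounded_gf (3, 0, 2) (int m) - bounded_gf (3, 0, 2) (int m - 1)
      = fps_X ^ m * A (4, 0, 1) + fps_X ^ m * A (2, 2, 1) - fps_X ^ (2 * m) * A (3, 1, 1)"
    using bounded_gf_rec_2[of 2 3 m] by (simp add: A_def r[unfolded One_nat_def])
  show "bounded_gf (3, 1, 1) (int m) - bounded_gf (3, 1, 1) (int m - 1)
      = fps_X ^ m * (A (2, 2, 1) + A (3, 0, 2) + A (4, 1, 0)) - fps_X ^ (2 * m) * (A (2, 2, 1) + A (4, 0, 1) + A (3, 2, 0))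
       + fps_X ^ (3 * m) * A (3, 1, 1)"
    using bounded_gf_rec_3[of 3 1 1 m] by (simp add: A_def r[unfolded One_nat_def numeral_2_eq_2] numeral_2_eq_2)
  show "bounded_gf (2, 2, 1) (int m) - bounded_gf (2, 2, 1) (int m - 1)
      = fps_X ^ m * (A (3, 1, 1) + A (2, 2, 1) + A (3, 2, 0)) - fps_X ^ (2 * m) * (A (2, 2, 1) + A (3, 1, 1) + A (3, 0, 2))
       + fps_X ^ (3 * m) * A (2, 2, 1)"
    using bounded_gf_rec_3[of 2 2 1 m] by (simp add: A_def r[unfolded One_nat_def] flip: numeral_2_eq_2)
qed

abbreviation "profiles5 \<equiv> {(5, 0, 0), (4, 1, 0), (4, 0, 1), (3, 2, 0), (3, 0, 2), (3, 1, 1), (2, 2, 1)} :: (nat \<times> nat \<times> nat) set"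

text \<open>By induction the two solutions agree at m, so their differences at m + 1 satisfy the
  homogeneous system. As m + 1 > 0, every term there carries a positive power of q, so a coefficient
  depends on earlier ones only.\<close>

lemma bounded_gf_eq_conv5:
  assumes "c \<in> profiles5"
  shows "fps_to_fls (bounded_gf c (int m)) = flsq.conv (h5 c) (int m)"
  using assms
proof (induction m arbitrary: c)
  case 0
  then show ?case
    by (auto simp: bounded_gf_0 flsq.conv_0 h5_def flsq.rec_defs)
next
  case (Suc m)
  let ?m = "Suc m"
  define \<delta> where "\<delta> = (\<lambda>c. fps_to_fls (bounded_gf c (int ?m)) - flsq.conv (h5 c) (int ?m))"
  have prev: "fps_to_fls (bounded_gf c (int ?m - 1)) = flsq.conv (h5 c) (int ?m - 1)" if "c \<in> profiles5" for c
    using Suc.IH[OF that] by simp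
  have split: "\<delta> c = fps_to_fls (bounded_gf c (int ?m) - bounded_gf c (int ?m - 1))
      - (flsq.conv (h5 c) (int ?m) - flsq.conv (h5 c) (int ?m - 1))" if "c \<in> profiles5" for c
    using prev[OF that] by (simp add: \<delta>_def)
  let ?X = "fls_X :: rat fls"
  have X: "?X powi int ?m = ?X ^ ?m" "(?X ^ ?m)\<^sup>2 = ?X ^ (2 * ?m)" "(?X ^ ?m) ^ 3 = ?X ^ (3 * ?m)"
    by (simp_all only: power_int_of_nat power_mult[symmetric] mult.commute)
  note rules = fps_to_fls_plus fps_to_fls_minus fls_times_fps_to_fls fps_to_fls_power fps_X_to_fls X
  have h: "h5 (5, 0, 0) = flsq.h500" "h5 (4, 1, 0) = flsq.h410" "h5 (4, 0, 1) = flsq.h401" "h5 (3, 2, 0) = flsq.h320"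
    "h5 (3, 0, 2) = flsq.h302" "h5 (3, 1, 1) = flsq.h311" "h5 (2, 2, 1) = flsq.h221"
    by (simp_all add: h5_def)
  have rec: "\<delta> (5, 0, 0) = ?X ^ ?m * \<delta> (4, 1, 0)"
    "\<delta> (4, 1, 0) = ?X ^ ?m * \<delta> (3, 2, 0) + ?X ^ ?m * \<delta> (4, 0, 1) - ?X ^ (2 * ?m) * \<delta> (3, 1, 1)"
    "\<delta> (4, 0, 1) = ?X ^ ?m * \<delta> (5, 0, 0) + ?X ^ ?m * \<delta> (3, 1, 1) - ?X ^ (2 * ?m) * \<delta> (4, 1, 0)"
    "\<delta> (3, 2, 0) = ?X ^ ?m * \<delta> (3, 0, 2) + ?X ^ ?m * \<delta> (3, 1, 1) - ?X ^ (2 * ?m) * \<delta> (2, 2, 1)"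
    "\<delta> (3, 0, 2) = ?X ^ ?m * \<delta> (4, 0, 1) + ?X ^ ?m * \<delta> (2, 2, 1) - ?X ^ (2 * ?m) * \<delta> (3, 1, 1)"
    "\<delta> (3, 1, 1) = ?X ^ ?m * (\<delta> (2, 2, 1) + \<delta> (3, 0, 2) + \<delta> (4, 1, 0))
       - ?X ^ (2 * ?m) * (\<delta> (2, 2, 1) + \<delta> (4, 0, 1) + \<delta> (3, 2, 0)) + ?X ^ (3 * ?m) * \<delta> (3, 1, 1)"
    "\<delta> (2, 2, 1) = ?X ^ ?m * (\<delta> (3, 1, 1) + \<delta> (2, 2, 1) + \<delta> (3, 2, 0))
       - ?X ^ (2 * ?m) * (\<delta> (2, 2, 1) + \<delta> (3, 1, 1) + \<delta> (3, 0, 2)) + ?X ^ (3 * ?m) * \<delta> (2, 2, 1)"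
    by (rule trans[OF split], simp, (unfold bounded_gf_level5 h flsq.conv_rec rules \<delta>_def)[1],
        (simp only: algebra_simps)[1])+
  have "\<delta> c = 0"
  proof (rule fls_system_zero[of profiles5 c \<delta>])
    fix c k assume c: "c \<in> profiles5" and *: "\<And>c' k'. c' \<in> profiles5 \<Longrightarrow> k' < k \<Longrightarrow> fls_nth (\<delta> c') k' = 0"
    have z: "fls_nth (?X ^ ?m * \<delta> c') k = 0" "fls_nth (?X ^ (2 * ?m) * \<delta> c') k = 0" "fls_nth (?X ^ (3 * ?m) * \<delta> c') k = 0"
      if "c' \<in> profiles5" for c'
      unfolding fls_X_power_mult_nth by (rule *, rule that, simp)+
    from c consider "c = (5, 0, 0)" | "c = (4, 1, 0)" | "c = (4, 0, 1)" | "c = (3, 2, 0)" | "c = (3, 0, 2)" | "c = (3, 1, 1)" | "c = (2, 2, 1)"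
      by auto
    then show "fls_nth (\<delta> c) k = 0"
      by cases (simp only:, subst rec, (simp only: distrib_left fls_plus_nth fls_minus_nth z
          insert_iff simp_thms add_0_left diff_self)[1])+
  qed (use Suc.prems in auto)
  then show ?case by (simp add: \<delta>_def)
qed

lemma bounded_gf_level2:
  "bounded_gf (2, 0, 0) (int m) - bounded_gf (2, 0, 0) (int m - 1) = fps_X ^ m * bounded_gf (1, 1, 0) (int m)"
  "bounded_gf (1, 1, 0) (int m) - bounded_gf (1, 1, 0) (int m - 1)
    = fps_X ^ m * bounded_gf (2, 0, 0) (int m) + fps_X ^ m * bounded_gf (1, 1, 0) (int m) - fps_X ^ (2 * m) * bounded_gf (1, 1, 0) (int m)"
proof -
  note rot = bounded_gf_rotate
  have r: "bounded_gf (0, 2, 0) n = bounded_gf (2, 0, 0) n" "bounded_gf (1, 0, 1) n = bounded_gf (1, 1, 0) n"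
    "bounded_gf (0, 1, 1) n = bounded_gf (1, 1, 0) n" for n
    by (rule rot rot[THEN trans, OF rot])+
  show "bounded_gf (2, 0, 0) (int m) - bounded_gf (2, 0, 0) (int m - 1) = fps_X ^ m * bounded_gf (1, 1, 0) (int m)"
    using bounded_gf_rec_1[of 2 m] by simp
  show "bounded_gf (1, 1, 0) (int m) - bounded_gf (1, 1, 0) (int m - 1)
    = fps_X ^ m * bounded_gf (2, 0, 0) (int m) + fps_X ^ m * bounded_gf (1, 1, 0) (int m) - fps_X ^ (2 * m) * bounded_gf (1, 1, 0) (int m)"
    using bounded_gf_rec_2[of 1 1 m] by (simp add: r[unfolded One_nat_def numeral_2_eq_2] numeral_2_eq_2)
qed

definition h2 :: "nat \<times> nat \<times> nat \<Rightarrow> int \<Rightarrow> rat fls" where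
  "h2 c = (if c = (2, 0, 0) then flsq.h200 else flsq.h110)"

abbreviation "profiles2 \<equiv> {(2, 0, 0), (1, 1, 0)} :: (nat \<times> nat \<times> nat) set"

lemma bounded_gf_eq_conv2:
  assumes "c \<in> profiles2"
  shows "fps_to_fls (bounded_gf c (int m)) = flsq.conv (h2 c) (int m)"
  using assms
proof (induction m arbitrary: c)
  case 0
  then show ?case
    by (auto simp: bounded_gf_0 flsq.conv_0 h2_def flsq.h110_def flsq.h200_def)
next
  case (Suc m)
  let ?m = "Suc m"
  define \<delta> where "\<delta> = (\<lambda>c. fps_to_fls (bounded_gf c (int ?m)) - flsq.conv (h2 c) (int ?m))"
  have prev: "fps_to_fls (bounded_gf c (int ?m - 1)) = flsq.conv (h2 c) (int ?m - 1)" if "c \<in> profiles2" for c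
    using Suc.IH[OF that] by simp
  have split: "\<delta> c = fps_to_fls (bounded_gf c (int ?m) - bounded_gf c (int ?m - 1))
      - (flsq.conv (h2 c) (int ?m) - flsq.conv (h2 c) (int ?m - 1))" if "c \<in> profiles2" for c
    using prev[OF that] by (simp add: \<delta>_def)
  let ?X = "fls_X :: rat fls"
  have X: "?X powi int ?m = ?X ^ ?m" "(?X ^ ?m)\<^sup>2 = ?X ^ (2 * ?m)"
    by (simp_all only: power_int_of_nat power_mult[symmetric] mult.commute)
  note rules = fps_to_fls_plus fps_to_fls_minus fls_times_fps_to_fls fps_to_fls_power fps_X_to_fls X
  have h: "h2 (2, 0, 0) = flsq.h200" "h2 (1, 1, 0) = flsq.h110"
    by (simp_all add: h2_def)
  have rec: "\<delta> (2, 0, 0) = ?X ^ ?m * \<delta> (1, 1, 0)"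
    "\<delta> (1, 1, 0) = ?X ^ ?m * \<delta> (2, 0, 0) + ?X ^ ?m * \<delta> (1, 1, 0) - ?X ^ (2 * ?m) * \<delta> (1, 1, 0)"
    by (rule trans[OF split], simp, (unfold bounded_gf_level2 h flsq.conv_rec_level2 rules \<delta>_def)[1],
        (simp only: algebra_simps)[1])+
  have "\<delta> c = 0"
  proof (rule fls_system_zero[of profiles2 c \<delta>])
    fix c k assume c: "c \<in> profiles2" and *: "\<And>c' k'. c' \<in> profiles2 \<Longrightarrow> k' < k \<Longrightarrow> fls_nth (\<delta> c') k' = 0"
    have z: "fls_nth (?X ^ ?m * \<delta> c') k = 0" "fls_nth (?X ^ (2 * ?m) * \<delta> c') k = 0"
      if "c' \<in> profiles2" for c'
      unfolding fls_X_power_mult_nth by (rule *, rule that, simp)+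
    from c consider "c = (2, 0, 0)" | "c = (1, 1, 0)" by auto
    then show "fls_nth (\<delta> c) k = 0"
      by cases (simp only:, subst rec, (simp only: distrib_left fls_plus_nth fls_minus_nth z
          insert_iff simp_thms add_0_left diff_self)[1])+
  qed (use Suc.prems in auto)
  then show ?case by (simp add: \<delta>_def)
qed


section \<open>Power series in two variables\<close>

lemma comm_inverse_unique:
  fixes a b c :: "'a::comm_monoid_mult"
  assumes "b * a = 1" "b * c = 1"
  shows "a = c"
  using assms by (metis mult.assoc mult.commute mult_1)

text \<open>Series in \<open>z\<close> over series in \<open>q\<close>, turned into series in \<open>q\<close> over series in \<open>z\<close>.\<close>

definition zq_of :: "(nat \<Rightarrow> rat fps) \<Rightarrow> zq_series" where
  "zq_of g = Abs_fps (\<lambda>N. Abs_fps (\<lambda>n. fps_nth (g n) N))"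

lemma zq_of_nth [simp]: "fps_nth (fps_nth (zq_of g) N) n = fps_nth (g n) N"
  by (simp add: zq_of_def)

lemma zq_eqI: "(\<And>N n. fps_nth (fps_nth f N) n = fps_nth (fps_nth g N) n) \<Longrightarrow> f = g" for f g :: zq_series
  by (simp add: fps_eq_iff)

lemma zq_of_diff: "zq_of f - zq_of g = zq_of (\<lambda>n. f n - g n)"
  by (rule zq_eqI) simp

lemma zq_of_mult: "zq_of f * zq_of g = zq_of (\<lambda>n. \<Sum>i\<le>n. f i * g (n - i))"
proof (rule zq_eqI)
  fix N n
  have "fps_nth (fps_nth (zq_of f * zq_of g) N) n = (\<Sum>M\<le>N. \<Sum>i\<le>n. fps_nth (f i) M * fps_nth (g (n - i)) (N - M))"
    by (simp add: fps_mult_nth fps_sum_nth atLeast0AtMost)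
  also have "\<dots> = (\<Sum>i\<le>n. \<Sum>M\<le>N. fps_nth (f i) M * fps_nth (g (n - i)) (N - M))"
    by (rule sum.swap)
  finally show "fps_nth (fps_nth (zq_of f * zq_of g) N) n = fps_nth (fps_nth (zq_of (\<lambda>n. \<Sum>i\<le>n. f i * g (n - i))) N) n"
    by (simp add: fps_mult_nth fps_sum_nth atLeast0AtMost)
qed

lemma var_q_power_mult_zq_of: "var_q ^ K * zq_of g = zq_of (\<lambda>n. fps_X ^ K * g n)"
  by (rule zq_eqI) (simp add: fps_X_power_mult_nth)

lemma var_z_mult_zq_of: "var_z * zq_of g = zq_of (\<lambda>n. if n = 0 then 0 else g (n - 1))"
  by (rule zq_eqI) simp

section \<open>Euler's expansion of 1/(z q^K;q)_inf\<close>

definition euler_series :: "nat \<Rightarrow> zq_series" where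
  "euler_series K = zq_of (\<lambda>n. fps_X ^ (n * K) / qfact fps_X n)"

lemma qfact_Suc_mult_divide:
  "(1 - fps_X ^ Suc n) * (f / qfact fps_X (Suc n)) = f / (qfact fps_X n :: rat fps)"
proof -
  have u: "fps_nth (qfact fps_X n :: rat fps) 0 \<noteq> 0" for n
    by (simp add: qfact_fps_nth_0)
  have "fps_nth (1 - fps_X ^ Suc n :: rat fps) 0 \<noteq> 0" by simp
  then have "(1 - fps_X ^ Suc n :: rat fps) * inverse (1 - fps_X ^ Suc n) = 1"
    by (rule inverse_mult_eq_1')
  moreover have "inverse (qfact fps_X (Suc n) :: rat fps) = inverse (1 - fps_X ^ Suc n) * inverse (qfact fps_X n)"
    unfolding qfact_Suc by (rule fps_inverse_mult)
  ultimately have "(1 - fps_X ^ Suc n :: rat fps) * inverse (qfact fps_X (Suc n)) = inverse (qfact fps_X n)"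
    by (simp only: mult.assoc[symmetric] mult_1)
  then show ?thesis
    by (simp only: fps_divide_unit[OF u] mult.left_commute[of _ f])
qed

text \<open>At z^n: q^(nK)/(q)_n - q^(nK)/(q)_(n-1) = q^(nK) (1 - (1 - q^n)) / (q)_n.\<close>

lemma euler_series_step: "(1 - var_z * var_q ^ K) * euler_series K = euler_series (Suc K)"
proof -
  have "(1 - var_z * var_q ^ K) * euler_series K = euler_series K - var_z * (var_q ^ K * euler_series K)"
    by (simp add: algebra_simps)
  also have "\<dots> = zq_of (\<lambda>n. fps_X ^ (n * K) / qfact fps_X n
      - (if n = 0 then 0 else fps_X ^ K * (fps_X ^ ((n - 1) * K) / qfact fps_X (n - 1))))"
    unfolding euler_series_def var_q_power_mult_zq_of var_z_mult_zq_of zq_of_diff ..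
  also have "\<dots> = euler_series (Suc K)"
    unfolding euler_series_def
  proof (rule arg_cong[where f = zq_of], rule ext)
    fix n
    show "fps_X ^ (n * K) / qfact fps_X n - (if n = 0 then 0 else fps_X ^ K * (fps_X ^ ((n - 1) * K) / qfact fps_X (n - 1)))
      = (fps_X ^ (n * Suc K) / qfact fps_X n :: rat fps)"
    proof (cases n)
      case (Suc m)
      have u: "fps_nth (qfact fps_X n :: rat fps) 0 \<noteq> 0" for n
        by (simp add: qfact_fps_nth_0)
      have "fps_X ^ K * (fps_X ^ (m * K) / qfact fps_X m) = (fps_X ^ K * fps_X ^ (m * K)) / (qfact fps_X m :: rat fps)"
        by (simp only: fps_divide_unit[OF u] mult.assoc)
      also have "\<dots> = (1 - fps_X ^ Suc m) * (fps_X ^ (n * K) / qfact fps_X n)"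
        unfolding Suc qfact_Suc_mult_divide by (simp add: power_add)
      finally have "fps_X ^ (n * K) / qfact fps_X n - (if n = 0 then 0 else fps_X ^ K * (fps_X ^ ((n - 1) * K) / qfact fps_X (n - 1)))
         = fps_X ^ n * (fps_X ^ (n * K) / (qfact fps_X n :: rat fps))"
        by (simp add: Suc algebra_simps)
      also have "\<dots> = fps_X ^ (n * Suc K) / qfact fps_X n"
        by (simp only: fps_divide_unit[OF u] mult.assoc[symmetric] power_add[symmetric] mult_Suc_right)
      finally show ?thesis .
    qed simp
  qed
  finally show ?thesis .
qed

lemma euler_series_prod: "(\<Prod>i<K. 1 - var_z * var_q * var_q ^ i) * euler_series 1 = euler_series (Suc K)"
proof (induction K)
  case (Suc K)
  have "(\<Prod>i<Suc K. 1 - var_z * var_q * var_q ^ i) * euler_series 1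
      = (1 - var_z * var_q ^ Suc K) * ((\<Prod>i<K. 1 - var_z * var_q * var_q ^ i) * euler_series 1)"
    by (simp add: mult_ac)
  then show ?case by (simp only: Suc.IH euler_series_step)
qed simp

lemma euler_series_nth:
  assumes "N < K"
  shows "fps_nth (euler_series K) N = fps_nth 1 N"
proof (rule fps_ext)
  fix n
  have "fps_nth (fps_X ^ (n * K) / qfact fps_X n :: rat fps) N = 0" if "n \<noteq> 0"
  proof -
    have "N < n * K" using assms that by (cases n) auto
    then show ?thesis
      by (simp add: fps_divide_unit qfact_fps_nth_0 fps_X_power_mult_nth)
  qed
  moreover have "fps_nth (fps_X ^ (0 * K) / qfact fps_X 0 :: rat fps) N = fps_nth 1 N"
    by simp
  ultimately show "fps_nth (fps_nth (euler_series K) N) n = fps_nth (fps_nth 1 N) n"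
    by (cases "n = 0") (auto simp: euler_series_def)
qed

text \<open>Multiplying by a finite product only moves K upwards, and \<open>euler_series K\<close>
  tends to 1 in the q-adic topology; up to q^N the infinite product agrees with a long finite
  one.\<close>

lemma qpoch_inf_mult_euler_series: "qpoch_inf (var_z * var_q) * euler_series 1 = 1"
proof (rule fps_ext)
  fix N
  let ?a = "var_z * var_q"
  let ?P = "\<lambda>n. \<Prod>i\<le>n. 1 - ?a * var_q ^ i"
  have "?P \<longlonglongrightarrow> qpoch_inf ?a"
    using has_prod_qpoch_inf[of ?a] qpoch_inf_nth_0[of ?a] by (auto simp: has_prod_def raw_has_prod_def)
  then have "eventually (\<lambda>n. \<forall>M\<in>{..N}. fps_nth (?P n) M = fps_nth (qpoch_inf ?a) M) sequentially"
    by (subst eventually_ball_finite_distrib) (auto simp: tendsto_fps_iff)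
  then have "eventually (\<lambda>n. (\<forall>M\<in>{..N}. fps_nth (?P n) M = fps_nth (qpoch_inf ?a) M) \<and> n \<ge> N) sequentially"
    using eventually_ge_at_top[of N] by (rule eventually_conj)
  then obtain n where n: "\<And>M. M \<le> N \<Longrightarrow> fps_nth (?P n) M = fps_nth (qpoch_inf ?a) M" "n \<ge> N"
    by (auto simp: eventually_sequentially)
  have "fps_nth (qpoch_inf ?a * euler_series 1) N = fps_nth (?P n * euler_series 1) N"
    unfolding fps_mult_nth by (intro sum.cong) (simp_all add: n(1))
  also have "?P n * euler_series 1 = euler_series (Suc (Suc n))"
    using euler_series_prod[of "Suc n"] by (simp only: lessThan_Suc_atMost)
  finally show "fps_nth (qpoch_inf ?a * euler_series 1) N = fps_nth 1 N"
    using euler_series_nth[of N "Suc (Suc n)"] n(2) by simp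
qed

lemma inverse_qpoch_inf: "1 / qpoch_inf (var_z * var_q) = euler_series 1"
proof -
  let ?Q = "qpoch_inf (var_z * var_q)"
  have Q0: "fps_nth ?Q 0 = 1"
    by (rule qpoch_inf_nth_0) simp
  have "?Q * inverse ?Q = 1"
    unfolding fps_inverse_def[of ?Q] by (rule fps_right_inverse) (simp add: Q0)
  then have "inverse ?Q = euler_series 1"
    using qpoch_inf_mult_euler_series by (rule comm_inverse_unique)
  moreover have "1 / ?Q = 1 * inverse ?Q"
    by (rule fps_divide_unit) (simp add: Q0)
  ultimately show ?thesis by simp
qed

section \<open>Series in q alone as series in z and q\<close>

definition const_z :: "rat fps \<Rightarrow> zq_series" where
  "const_z f = Abs_fps (\<lambda>N. fps_const (fps_nth f N))"

lemma const_z_nth [simp]: "fps_nth (const_z f) N = fps_const (fps_nth f N)"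
  by (simp add: const_z_def)

lemma const_z_0 [simp]: "const_z 0 = 0"
  by (simp add: fps_eq_iff)

lemma const_z_1 [simp]: "const_z 1 = 1"
  by (rule fps_ext) simp

lemma const_z_X [simp]: "const_z fps_X = fps_X"
  by (rule fps_ext) simp

lemma const_z_diff: "const_z (f - g) = const_z f - const_z g"
  by (rule fps_ext) simp

lemma const_z_mult: "const_z (f * g) = const_z f * const_z g"
proof (rule fps_ext)
  fix N
  have "fps_const (sum h A) = (\<Sum>x\<in>A. fps_const (h x))" for h :: "nat \<Rightarrow> rat" and A
    by (induction A rule: infinite_finite_induct) (simp_all flip: fps_const_add)
  then show "fps_nth (const_z (f * g)) N = fps_nth (const_z f * const_z g) N"
    by (simp add: fps_mult_nth fps_const_mult)
qed

lemma const_z_power: "const_z (f ^ n) = const_z f ^ n"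
  by (induction n) (simp_all add: const_z_mult)

text \<open>The coefficients of a \<open>zq_series\<close> are power series, not field elements, so
  the quotient is identified through uniqueness of inverses.\<close>

lemma const_z_divide:
  assumes "fps_nth g 0 \<noteq> 0"
  shows "const_z (f / g) = const_z f / const_z g"
proof -
  have g: "fps_nth (const_z g) 0 * inverse (fps_nth (const_z g) 0) = 1"
    using assms by (intro inverse_mult_eq_1') simp
  have "const_z g * inverse (const_z g) = 1"
    unfolding fps_inverse_def[of "const_z g"] by (rule fps_right_inverse) (rule g)
  moreover have "const_z g * const_z (inverse g) = 1"
    using assms by (simp flip: const_z_mult add: inverse_mult_eq_1')
  ultimately have "inverse (const_z g) = const_z (inverse g)"
    by (rule comm_inverse_unique)
  moreover have "const_z f / const_z g = const_z f * inverse (const_z g)"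
    by (rule fps_divide_unit) (use assms in simp)
  ultimately show ?thesis
    using assms by (simp add: fps_divide_unit const_z_mult)
qed

lemma qpoch_eq_const_z: "qpoch var_q n = const_z (qfact fps_X n)"
proof -
  have "qpoch var_q n = (\<Prod>i<n. 1 - var_q * var_q ^ i)"
    by (rule qpoch_eq_prod) simp
  also have "\<dots> = const_z (qfact fps_X n)"
    by (induction n) (simp_all add: qfact_Suc const_z_mult const_z_diff const_z_power mult.commute)
  finally show ?thesis .
qed

definition fps_gauss :: "nat \<Rightarrow> nat \<Rightarrow> rat fps" where
  "fps_gauss n m = (if m \<le> n then qfact fps_X n / (qfact fps_X m * qfact fps_X (n - m)) else 0)"

lemma qbinom_eq_const_z: "qbinom (int n) (int m) = const_z (fps_gauss n m)"
proof -
  have "nat (int n - int m) = n - m" by simp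
  then show ?thesis
    by (simp add: qbinom_def fps_gauss_def qpoch_eq_const_z const_z_divide const_z_mult qfact_fps_nth_0)
qed

text \<open>By \<open>bound\<close> and \<open>fin\<close> only finitely many indices contribute to
  q^N, which is summability; the constant 2 suffices for the quadratic exponents that occur.\<close>

lemma infsum_var_z_const_z:
  fixes G :: "'i \<Rightarrow> rat fps" and \<rho> :: "'i \<Rightarrow> nat"
  assumes fin: "\<And>r. finite {x \<in> I. \<rho> x = r}"
    and bound: "\<And>x N. x \<in> I \<Longrightarrow> fps_nth (G x) N \<noteq> 0 \<Longrightarrow> \<rho> x \<le> 2 * N"
  shows "(\<Sum>\<^sub>\<infinity>x\<in>I. var_z ^ \<rho> x * const_z (G x)) = zq_of (\<lambda>r. \<Sum>x | x \<in> I \<and> \<rho> x = r. G x)"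
proof (rule infsumI, rule has_sum_fpsI)
  have nth: "fps_nth (var_z ^ \<rho> x * const_z (G x)) N = fps_X ^ \<rho> x * fps_const (fps_nth (G x) N)" for x N
    by (simp add: fps_const_power)
  have ne: "fps_nth (var_z ^ \<rho> x * const_z (G x)) N \<noteq> 0 \<longleftrightarrow> fps_nth (G x) N \<noteq> 0" for x N
    by (simp add: nth)
  have "{x \<in> I. fps_nth (G x) N \<noteq> 0} \<subseteq> (\<Union>r\<le>2 * N. {x \<in> I. \<rho> x = r})" for N
    using bound by blast
  then have finite: "finite {x \<in> I. fps_nth (G x) N \<noteq> 0}" for N
    by (rule finite_subset) (simp add: fin)
  then show "finite {x \<in> I. fps_nth (var_z ^ \<rho> x * const_z (G x)) N \<noteq> 0}" for N
    unfolding ne .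
  fix N
  show "fps_nth (zq_of (\<lambda>r. \<Sum>x | x \<in> I \<and> \<rho> x = r. G x)) N
    = (\<Sum>x | x \<in> I \<and> fps_nth (var_z ^ \<rho> x * const_z (G x)) N \<noteq> 0. fps_nth (var_z ^ \<rho> x * const_z (G x)) N)"
  proof (rule fps_ext)
    fix r
    have "fps_nth (\<Sum>x | x \<in> I \<and> fps_nth (var_z ^ \<rho> x * const_z (G x)) N \<noteq> 0. fps_nth (var_z ^ \<rho> x * const_z (G x)) N) r
      = (\<Sum>x | x \<in> I \<and> fps_nth (G x) N \<noteq> 0. if \<rho> x = r then fps_nth (G x) N else 0)"
      unfolding ne unfolding nth fps_sum_nth by (intro sum.cong) (auto simp: fps_X_power_mult_nth)
    also have "\<dots> = (\<Sum>x\<in>{x \<in> {x \<in> I. fps_nth (G x) N \<noteq> 0}. \<rho> x = r}. fps_nth (G x) N)"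
      by (rule sum.inter_filter[symmetric]) (rule finite)
    also have "\<dots> = (\<Sum>x | x \<in> I \<and> \<rho> x = r. fps_nth (G x) N)"
      by (rule sum.mono_neutral_left) (use fin in auto)
    finally show "fps_nth (fps_nth (zq_of (\<lambda>r. \<Sum>x | x \<in> I \<and> \<rho> x = r. G x)) N) r
      = fps_nth (\<Sum>x | x \<in> I \<and> fps_nth (var_z ^ \<rho> x * const_z (G x)) N \<noteq> 0. fps_nth (var_z ^ \<rho> x * const_z (G x)) N) r"
      by (simp add: fps_sum_nth)
  qed
qed


section \<open>The double sums as generating functions\<close>

text \<open>G_c has the coefficients A(n) - A(n-1), which by \<open>conv_bdiff_iqf\<close> are those
  of 1/(zq;q)_inf times the series of the \<open>H r\<close>. The Laurent series \<open>h r\<close>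
  have to be power series for r \<ge> 0 only.\<close>

lemma cp_series_eq:
  assumes conv: "\<And>m. fps_to_fls (bounded_gf c (int m)) = flsq.conv h (int m)"
    and h: "\<And>r. h (int r) = fps_to_fls (H r)"
  shows "cp_series c = 1 / qpoch_inf (var_z * var_q) * zq_of H"
proof -
  have "bounded_gf c (int n) - bounded_gf c (int n - 1) = (\<Sum>i\<le>n. fps_X ^ (i * 1) / qfact fps_X i * H (n - i))" for n
  proof -
    have "fps_to_fls (bounded_gf c (int n) - bounded_gf c (int n - 1)) = flsq.conv h (int n) - flsq.conv h (int n - 1)"
    proof (cases n)
      case 0
      then show ?thesis using conv[of 0] by (simp add: bounded_gf_neg flsq.conv_neg)
    next
      case (Suc m)
      then show ?thesis using conv[of n] conv[of m] by simp
    qed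
    also have "\<dots> = (\<Sum>r\<in>{0..int n}. h r * (fls_X powi (int n - r) * flsq.iqf (int n - r)))"
      by (rule flsq.conv_bdiff_iqf)
    also have "\<dots> = (\<Sum>i\<le>n. fps_to_fls (fps_X ^ (i * 1) / qfact fps_X i * H (n - i)))"
    proof (rule sum.reindex_bij_witness[of _ "\<lambda>i. int (n - i)" "\<lambda>r. nat (int n - r)"])
      fix r assume r: "r \<in> {0..int n}"
      define i where "i = nat (int n - r)"
      have i: "int n - r = int i" "r = int (n - i)" using r by (auto simp: i_def)
      show "fps_to_fls (fps_X ^ (nat (int n - r) * 1) / qfact fps_X (nat (int n - r)) * H (n - nat (int n - r)))
        = h r * (fls_X powi (int n - r) * flsq.iqf (int n - r))"
        unfolding i(1) unfolding i(2) h
        by (simp add: fls_times_fps_to_fls fps_to_fls_divide qfact_fps_nth_0 fps_to_fls_power fps_to_fls_qfact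
            flsq.iqf_of_nat divide_inverse mult_ac)
    qed auto
    finally have "fps_to_fls (bounded_gf c (int n) - bounded_gf c (int n - 1))
        = fps_to_fls (\<Sum>i\<le>n. fps_X ^ (i * 1) / qfact fps_X i * H (n - i))"
      by (simp only: fps_to_fls_sum)
    then show ?thesis by (simp only: fps_to_fls_eq_iff)
  qed
  then show ?thesis
    unfolding inverse_qpoch_inf euler_series_def zq_of_mult
    by (intro zq_eqI) (simp only: cp_series_nth zq_of_nth)
qed

lemma const_z_divide_qfact: "const_z (f / qfact fps_X n) = const_z f / qpoch var_q n"
  by (simp add: const_z_divide qfact_fps_nth_0 qpoch_eq_const_z)

lemma divide_qpoch: "f / qpoch var_q n = f * inverse (qpoch var_q n)"
  by (rule fps_divide_unit) (simp add: qpoch_eq_const_z qfact_fps_nth_0)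

lemma sum_indices_1:
  assumes "\<And>r. r \<le> A r"
  shows "(\<Sum>\<^sub>\<infinity>(n, m)\<in>sum_indices 1. var_z ^ n 1 * var_q ^ A (n 1) / qpoch var_q (n 1))
    = zq_of (\<lambda>r. fps_X ^ A r / qfact fps_X r)"
proof -
  define G :: "nat \<Rightarrow> rat fps" where "G r = fps_X ^ A r / qfact fps_X r" for r
  have "(\<Sum>\<^sub>\<infinity>(n, m)\<in>sum_indices 1. var_z ^ n 1 * var_q ^ A (n 1) / qpoch var_q (n 1))
     = (\<Sum>\<^sub>\<infinity>r\<in>UNIV. var_z ^ r * const_z (G r))"
  proof (rule infsum_reindex_bij_witness[of _ "\<lambda>r. (restrict (\<lambda>_. r) {1}, restrict (\<lambda>_. 2 * r) {1})" "\<lambda>(n, m). n 1"])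
    fix a assume "a \<in> sum_indices 1"
    then obtain n m where a: "a = (n, m)" "n \<in> {1} \<rightarrow>\<^sub>E UNIV" "m \<in> {1} \<rightarrow>\<^sub>E UNIV" "m 1 = 2 * n 1"
      by (auto simp: sum_indices_def)
    then have "n = restrict (\<lambda>_. n 1) {1}" "m = restrict (\<lambda>_. 2 * n 1) {1}"
      by (auto simp: PiE_def extensional_def fun_eq_iff restrict_def)
    then show "(restrict (\<lambda>_. case a of (n, m) \<Rightarrow> n 1) {1}, restrict (\<lambda>_. 2 * (case a of (n, m) \<Rightarrow> n 1)) {1}) = a"
      by (simp add: a)
    show "var_z ^ (case a of (n, m) \<Rightarrow> n 1) * const_z (G (case a of (n, m) \<Rightarrow> n 1))
      = (case a of (n, m) \<Rightarrow> var_z ^ n 1 * var_q ^ A (n 1) / qpoch var_q (n 1))"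
      by (simp add: a G_def const_z_divide_qfact const_z_power divide_qpoch mult.assoc)
  qed (auto simp: sum_indices_def)
  also have "\<dots> = zq_of (\<lambda>r. \<Sum>x | x \<in> UNIV \<and> x = r. G x)"
  proof (rule infsum_var_z_const_z)
    fix r N assume *: "fps_nth (G r) N \<noteq> 0"
    have "\<not> N < A r"
      using * by (auto simp: G_def fps_divide_unit qfact_fps_nth_0 fps_X_power_mult_nth)
    then show "r \<le> 2 * N" using assms[of r] by simp
  qed simp
  finally show ?thesis by (simp add: G_def)
qed

lemma sum_indices_2:
  assumes B: "\<And>r l. r * r + l * l - r * l \<le> B r l"
  shows "(\<Sum>\<^sub>\<infinity>(n, m)\<in>sum_indices 2. var_z ^ n 1 * var_q ^ A (n 1) (n 2) / qpoch var_q (n 1) *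
      (var_q ^ B (n 1) (m 1) * qbinom (int (n 1)) (int (n 2)) * qbinom (int (n 1) - int (n 2) + int (m 2)) (int (m 1))))
    = zq_of (\<lambda>r. \<Sum>j\<le>r. \<Sum>l\<le>r + j. fps_X ^ (A r j + B r l) / qfact fps_X r * (fps_gauss r j * fps_gauss (r + j) l))"
proof -
  define G :: "nat \<Rightarrow> nat \<Rightarrow> nat \<Rightarrow> rat fps" where
    "G r j l = fps_X ^ (A r j + B r l) / qfact fps_X r * (fps_gauss r j * fps_gauss (r + j) l)" for r j l
  let ?T = "\<lambda>(n, m). var_z ^ n 1 * var_q ^ A (n 1) (n 2) / qpoch var_q (n 1) *
      (var_q ^ B (n 1) (m 1) * qbinom (int (n 1)) (int (n 2)) * qbinom (int (n 1) - int (n 2) + int (m 2)) (int (m 1)))"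
  \<comment> \<open>Outside \<open>S\<close> one of the two q-binomials vanishes; inside, n_2 and
    m_1 are bounded in terms of n_1.\<close>
  define S where "S = {(n, m) \<in> sum_indices 2. n 2 \<le> n 1 \<and> m 1 \<le> n 1 + n (2 :: nat)}"
  define I :: "(nat \<times> nat \<times> nat) set" where "I = {(r, j, l). j \<le> r \<and> l \<le> r + j}"
  have ivl: "{1..2} = {1, 2 :: nat}" by auto
  have T: "?T (n, m) = var_z ^ n 1 * const_z (G (n 1) (n 2) (m 1))" if "(n, m) \<in> sum_indices 2" for n m
  proof -
    \<comment> \<open>m_2 = 2 n_2 turns the upper entry n_1 - n_2 + m_2 into n_1 + n_2, the length
      in \<open>qsum\<close>.\<close>
    have "int (n 1) - int (n 2) + int (m 2) = int (n 1 + n 2)"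
      using that by (simp add: sum_indices_def)
    then show ?thesis
      by (simp only: prod.case qbinom_eq_const_z)
         (simp add: G_def const_z_mult const_z_divide_qfact const_z_power divide_qpoch power_add mult_ac)
  qed
  have inner: "(\<Sum>x | x \<in> I \<and> fst x = r. case x of (r, j, l) \<Rightarrow> G r j l) = (\<Sum>j\<le>r. \<Sum>l\<le>r + j. G r j l)" for r
  proof -
    have "(\<Sum>x | x \<in> I \<and> fst x = r. case x of (r, j, l) \<Rightarrow> G r j l) = (\<Sum>(j, l)\<in>(SIGMA j:{..r}. {..r + j}). G r j l)"
      by (rule sum.reindex_bij_witness[of _ "\<lambda>(j, l). (r, j, l)" snd]) (auto simp: I_def)
    then show ?thesis by (simp add: sum.Sigma)
  qed
  have "infsum ?T (sum_indices 2) = infsum ?T S"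
  proof (rule infsum_cong_neutral)
    fix x assume x: "x \<in> sum_indices 2 - S"
    obtain n m where nm: "x = (n, m)" by (cases x)
    have "\<not> (n 2 \<le> n 1 \<and> m 1 \<le> n 1 + n 2)" using x by (auto simp: nm S_def)
    then have "G (n 1) (n 2) (m 1) = 0" by (auto simp: G_def fps_gauss_def)
    then show "?T x = 0" using T[of n m] x by (simp add: nm)
  qed (auto simp: S_def)
  also have "\<dots> = infsum (\<lambda>x. var_z ^ fst x * const_z (case x of (r, j, l) \<Rightarrow> G r j l)) I"
  proof (rule infsum_reindex_bij_witness[of _ "\<lambda>(r, j, l). (restrict (\<lambda>i. if i = 1 then r else j) {1..2},
        restrict (\<lambda>i. if i = 1 then l else 2 * j) {1..2})" "\<lambda>(n, m). (n 1, n 2, m 1)"])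
    fix a assume aS: "a \<in> S"
    then obtain n m where a: "a = (n, m)" "n \<in> {1..2} \<rightarrow>\<^sub>E UNIV" "m \<in> {1..2} \<rightarrow>\<^sub>E UNIV" "m 2 = 2 * n 2"
      by (auto simp: sum_indices_def S_def)
    then have eq: "n = restrict (\<lambda>i. if i = 1 then n 1 else n 2) {1..2}" "m = restrict (\<lambda>i. if i = 1 then m 1 else 2 * n 2) {1..2}"
      unfolding ivl by (auto simp: PiE_def extensional_def fun_eq_iff restrict_def)
    show "(case case a of (n, m) \<Rightarrow> (n 1, n 2, m 1) of (r, j, l) \<Rightarrow> (restrict (\<lambda>i. if i = 1 then r else j) {1..2},
        restrict (\<lambda>i. if i = 1 then l else 2 * j) {1..2})) = a"
      by (simp only: a prod.case eq[symmetric])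
    show "var_z ^ fst (case a of (n, m) \<Rightarrow> (n 1, n 2, m 1)) *
        const_z (case case a of (n, m) \<Rightarrow> (n 1, n 2, m 1) of (r, j, l) \<Rightarrow> G r j l) = ?T a"
      using T[of n m] aS by (simp add: a(1) S_def)
  qed (auto simp: S_def I_def sum_indices_def)
  also have "\<dots> = zq_of (\<lambda>r. \<Sum>x | x \<in> I \<and> fst x = r. case x of (r, j, l) \<Rightarrow> G r j l)"
  proof (rule infsum_var_z_const_z)
    fix r
    have "{x \<in> I. fst x = r} \<subseteq> {r} \<times> {..r} \<times> {..r + r}"
      by (auto simp: I_def)
    then show "finite {x \<in> I. fst x = r}" by (rule finite_subset) simp
  next
    fix x N assume *: "fps_nth (case x of (r, j, l) \<Rightarrow> G r j l) N \<noteq> 0"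
    obtain r j l where x: "x = (r, j, l)" by (cases x)
    have "\<not> N < A r j + B r l"
      using * by (auto simp: x G_def fps_divide_unit qfact_fps_nth_0 fps_X_power_mult_nth mult.assoc)
    then have "int (r * r + l * l - r * l) \<le> int N" using B[of r l] by simp
    moreover have "int (r * r + l * l) \<le> int (r * r + l * l - r * l) + int (r * l)" by linarith
    ultimately have N: "int r * int r + int l * int l \<le> int N + int r * int l" by simp
    \<comment> \<open>4 (r^2 - r l + l^2) = 3 r^2 + (r - 2 l)^2, so the exponent of q controls
      n_1.\<close>
    have "0 \<le> (int r - 2 * int l) * (int r - 2 * int l)" by (rule zero_le_square)
    then have "3 * (int r * int r) \<le> 4 * int N" using N by (simp add: algebra_simps)
    moreover have "int r \<le> int r * int r" by (cases r) simp_all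
    ultimately show "fst x \<le> 2 * N" by (simp add: x)
  qed
  finally show ?thesis
    unfolding inner unfolding G_def .
qed

lemma fps_to_fls_gauss: "fps_to_fls (fps_gauss n m) = flsq.gauss n m"
  by (simp add: fps_gauss_def flsq.gauss_def fps_to_fls_divide fls_times_fps_to_fls fps_to_fls_qfact qfact_fps_nth_0)

lemma fps_to_fls_double_sum:
  assumes "\<And>j l. int (e r j l) = t + (int (r * r + j * j + l * l) - int (r * l) + a * int j + b * int l)"
  shows "fps_to_fls (\<Sum>j\<le>r. \<Sum>l\<le>r + j. fps_X ^ e r j l / qfact fps_X r * (fps_gauss r j * fps_gauss (r + j) l))
    = fls_X powi t * flsq.s a b (int r)"
proof -
  have "fls_X ^ e r j l = fls_X powi t * (fls_X powi (int (r * r + j * j + l * l) - int (r * l) + a * int j + b * int l) :: rat fls)" for j l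
    unfolding flsq.powi_add[symmetric] assms[symmetric] by simp
  then show ?thesis
    by (simp add: flsq.s_eq_double_sum fps_to_fls_sum fls_times_fps_to_fls fps_to_fls_divide qfact_fps_nth_0
        fps_to_fls_power fps_to_fls_qfact fps_to_fls_gauss sum_distrib_left mult.assoc)
qed

text \<open>As r l is at most the larger of r^2 and l^2, the subtraction of naturals is
  exact.\<close>

lemma quad_exponent: "int (r\<^sup>2 + l\<^sup>2 - r * l) = int (r * r + l * l) - int (r * l)" for r l :: nat
proof -
  have "r * l \<le> r * r + l * l"
  proof (cases "r \<le> l")
    case True
    then have "r * l \<le> l * l" by (intro mult_right_mono) simp_all
    then show ?thesis by (rule trans_le_add2)
  next
    case False
    then have "r * l \<le> r * r" by (intro mult_left_mono) simp_all
    then show ?thesis by (rule trans_le_add1)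
  qed
  then show ?thesis by (simp add: power2_eq_square of_nat_diff)
qed

text \<open>All four sums at k = 2 in one form: t, a and b are the weights of n_1, n_2 and m_1 in
  the linear part of the exponent. Summability is drawn from \<open>B\<close> alone, with b \<ge>
  0.\<close>

lemma cp_series_level5:
  assumes "c \<in> profiles5"
    and "\<And>r. h5 c (int r) = fls_X powi (t * int r) * flsq.s a b (int r)"
    and "\<And>r j l. int (A r j) = t * int r + int (j * j) + a * int j"
    and "\<And>r l. int (B r l) = int (r * r + l * l) - int (r * l) + b * int l" "b \<ge> 0"
  shows "cp_series c = 1 / qpoch_inf (var_z * var_q) *
    (\<Sum>\<^sub>\<infinity>(n, m)\<in>sum_indices 2. var_z ^ n 1 * var_q ^ A (n 1) (n 2) / qpoch var_q (n 1) *
      (var_q ^ B (n 1) (m 1) * qbinom (int (n 1)) (int (n 2)) * qbinom (int (n 1) - int (n 2) + int (m 2)) (int (m 1))))"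
proof -
  have "r * r + l * l - r * l \<le> B r l" for r l
  proof -
    have "0 \<le> b * int l" using assms(5) by simp
    then have "int (r * r + l * l - r * l) \<le> int (B r l)"
      using quad_exponent[of r l] assms(4)[of r l] by (simp add: power2_eq_square)
    then show ?thesis by simp
  qed
  moreover have "h5 c (int r) = fps_to_fls (\<Sum>j\<le>r. \<Sum>l\<le>r + j.
      fps_X ^ (A r j + B r l) / qfact fps_X r * (fps_gauss r j * fps_gauss (r + j) l))" for r
    unfolding assms(2) by (rule fps_to_fls_double_sum[symmetric]) (simp add: assms(3,4))
  ultimately show ?thesis
    by (subst sum_indices_2) (simp, rule cp_series_eq[OF bounded_gf_eq_conv5[OF assms(1)]])
qed

lemma cp_series_level2:
  assumes "c \<in> profiles2"
    and "\<And>r. h2 c (int r) = fls_X powi (t * int r) * flsq.h110 (int r)"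
    and "\<And>r. int (A r) = t * int r + int (r * r)" "t \<ge> 0"
  shows "cp_series c = 1 / qpoch_inf (var_z * var_q) *
    (\<Sum>\<^sub>\<infinity>(n, m)\<in>sum_indices 1. var_z ^ n 1 * var_q ^ A (n 1) / qpoch var_q (n 1))"
proof -
  have "r \<le> A r" for r
  proof -
    have "int r \<le> int (r * r)" by (cases r) simp_all
    moreover have "0 \<le> t * int r" using assms(4) by simp
    ultimately show ?thesis using assms(3)[of r] by linarith
  qed
  moreover have "h2 c (int r) = fps_to_fls (fps_X ^ A r / qfact fps_X r)" for r
  proof -
    have "fls_X ^ A r = fls_X powi (t * int r) * (fls_X powi (int r * int r) :: rat fls)"
      unfolding flsq.powi_add[symmetric] using assms(3)[of r] by (metis of_nat_mult power_int_of_nat)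
    then show ?thesis
      by (simp add: assms(2) flsq.h110_def flsq.iqf_of_nat fps_to_fls_divide qfact_fps_nth_0 fps_to_fls_power
          fps_to_fls_qfact divide_inverse mult.assoc)
  qed
  ultimately show ?thesis
    by (subst sum_indices_1) (simp, rule cp_series_eq[OF bounded_gf_eq_conv2[OF assms(1)]])
qed

theorem theorem2p6:
  fixes k :: nat
  assumes "k \<in> {1, 2}"
  shows
    "cp_series (k, k, k - 1) =
       1 / qpoch_inf (var_z * var_q) *
       (\<Sum>\<^sub>\<infinity>(n, m)\<in>sum_indices k.
          var_z ^ n 1 * var_q ^ ((n k)\<^sup>2) / qpoch var_q (n 1) *
          (\<Prod>i=1..k-1.
             var_q ^ ((n i)\<^sup>2 + (m i)\<^sup>2 - n i * m i) *
             qbinom (int (n i)) (int (n (i + 1))) *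
             qbinom (int (n i) - int (n (i + 1)) + int (m (i + 1))) (int (m i)))) \<and>
     (\<forall>s::nat. 1 \<le> s \<and> s \<le> k + 1 \<longrightarrow>
        cp_series (3 * k - s, s - 1, 0) =
          1 / qpoch_inf (var_z * var_q) *
          (\<Sum>\<^sub>\<infinity>(n, m)\<in>sum_indices k.
             var_z ^ n 1 * var_q ^ ((n k)\<^sup>2 + (\<Sum>i=s..k. n i)) / qpoch var_q (n 1) *
             (\<Prod>i=1..k-1.
                var_q ^ ((n i)\<^sup>2 + (m i)\<^sup>2 - n i * m i + m i) *
                qbinom (int (n i)) (int (n (i + 1))) *
                qbinom (int (n i) - int (n (i + 1)) + int (m (i + 1))) (int (m i)))))"
proof (cases "k = 1")
  case True
  have "1 \<le> s \<and> s \<le> k + 1 \<longleftrightarrow> s = 1 \<or> s = 2" for s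
    using True by auto
  \<comment> \<open>For s = 2 the profile is again (1, 1, 0) and the sum over i from s to k is
    empty, so this serves both identities.\<close>
  moreover have "cp_series (1, 1, 0) = 1 / qpoch_inf (var_z * var_q) *
    (\<Sum>\<^sub>\<infinity>(n, m)\<in>sum_indices 1. var_z ^ n 1 * var_q ^ (n 1)\<^sup>2 / qpoch var_q (n 1))"
    by (rule cp_series_level2[where t = 0 and A = "\<lambda>r. r\<^sup>2"]) (simp_all add: h2_def power2_eq_square)
  moreover have "cp_series (2, 0, 0) = 1 / qpoch_inf (var_z * var_q) *
    (\<Sum>\<^sub>\<infinity>(n, m)\<in>sum_indices 1. var_z ^ n 1 * var_q ^ ((n 1)\<^sup>2 + n 1) / qpoch var_q (n 1))"
    by (rule cp_series_level2[where t = 1 and A = "\<lambda>r. r\<^sup>2 + r"]) (simp_all add: h2_def power2_eq_square flsq.h200_def)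
  ultimately show ?thesis
    by (auto simp: True)
next
  case False
  then have k: "k = 2" using assms by simp
  have ivl: "{1..2} = {1, 2::nat}" by auto
  have c221: "cp_series (2, 2, 1) = 1 / qpoch_inf (var_z * var_q) *
    (\<Sum>\<^sub>\<infinity>(n, m)\<in>sum_indices 2. var_z ^ n 1 * var_q ^ (n 2)\<^sup>2 / qpoch var_q (n 1) *
      (var_q ^ ((n 1)\<^sup>2 + (m 1)\<^sup>2 - n 1 * m 1) * qbinom (int (n 1)) (int (n 2)) * qbinom (int (n 1) - int (n 2) + int (m 2)) (int (m 1))))"
    by (rule cp_series_level5[where t = 0 and a = 0 and b = 0 and A = "\<lambda>r j. j\<^sup>2" and B = "\<lambda>r l. r\<^sup>2 + l\<^sup>2 - r * l"])
       (simp_all add: h5_def flsq.h221_def power2_eq_square quad_exponent[unfolded power2_eq_square])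
  have c500: "cp_series (5, 0, 0) = 1 / qpoch_inf (var_z * var_q) *
    (\<Sum>\<^sub>\<infinity>(n, m)\<in>sum_indices 2. var_z ^ n 1 * var_q ^ ((n 2)\<^sup>2 + (n 1 + n 2)) / qpoch var_q (n 1) *
      (var_q ^ ((n 1)\<^sup>2 + (m 1)\<^sup>2 - n 1 * m 1 + m 1) * qbinom (int (n 1)) (int (n 2)) * qbinom (int (n 1) - int (n 2) + int (m 2)) (int (m 1))))"
    by (rule cp_series_level5[where t = 1 and a = 1 and b = 1 and A = "\<lambda>r j. j\<^sup>2 + (r + j)" and B = "\<lambda>r l. r\<^sup>2 + l\<^sup>2 - r * l + l"])
       (simp_all add: h5_def flsq.h500_def power2_eq_square quad_exponent[unfolded power2_eq_square])
  have c410: "cp_series (4, 1, 0) = 1 / qpoch_inf (var_z * var_q) *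
    (\<Sum>\<^sub>\<infinity>(n, m)\<in>sum_indices 2. var_z ^ n 1 * var_q ^ ((n 2)\<^sup>2 + n 2) / qpoch var_q (n 1) *
      (var_q ^ ((n 1)\<^sup>2 + (m 1)\<^sup>2 - n 1 * m 1 + m 1) * qbinom (int (n 1)) (int (n 2)) * qbinom (int (n 1) - int (n 2) + int (m 2)) (int (m 1))))"
    by (rule cp_series_level5[where t = 0 and a = 1 and b = 1 and A = "\<lambda>r j. j\<^sup>2 + j" and B = "\<lambda>r l. r\<^sup>2 + l\<^sup>2 - r * l + l"])
       (simp_all add: h5_def flsq.h410_def power2_eq_square quad_exponent[unfolded power2_eq_square])
  have c320: "cp_series (3, 2, 0) = 1 / qpoch_inf (var_z * var_q) *
    (\<Sum>\<^sub>\<infinity>(n, m)\<in>sum_indices 2. var_z ^ n 1 * var_q ^ (n 2)\<^sup>2 / qpoch var_q (n 1) *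
      (var_q ^ ((n 1)\<^sup>2 + (m 1)\<^sup>2 - n 1 * m 1 + m 1) * qbinom (int (n 1)) (int (n 2)) * qbinom (int (n 1) - int (n 2) + int (m 2)) (int (m 1))))"
    by (rule cp_series_level5[where t = 0 and a = 0 and b = 1 and A = "\<lambda>r j. j\<^sup>2" and B = "\<lambda>r l. r\<^sup>2 + l\<^sup>2 - r * l + l"])
       (simp_all add: h5_def flsq.h320_def power2_eq_square quad_exponent[unfolded power2_eq_square])
  have e: "(1::nat) + 1 = 2" "(2::nat) - 1 = 1" "(3::nat) - 1 = 2" "3 * 2 - 1 = (5::nat)" "3 * 2 - 2 = (4::nat)" "3 * 2 - 3 = (3::nat)"
    "(1::nat) - 1 = 0" "(\<Sum>i = 1..2. n i) = n 1 + n 2" "(\<Sum>i = 2..2. n i) = n 2" "(\<Sum>i = 3..2. n i) = 0" for n :: "nat \<Rightarrow> nat"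
    by (simp_all add: ivl numeral_eq_Suc)
  have prod1: "(\<Prod>i=1..1. f i) = f 1" for f :: "nat \<Rightarrow> zq_series" by simp
  show ?thesis
    unfolding k
  proof (intro conjI allI impI)
    show "cp_series (2, 2, 2 - 1) = 1 / qpoch_inf (var_z * var_q) *
       (\<Sum>\<^sub>\<infinity>(n, m)\<in>sum_indices 2.
          var_z ^ n 1 * var_q ^ ((n 2)\<^sup>2) / qpoch var_q (n 1) *
          (\<Prod>i=1..2-1.
             var_q ^ ((n i)\<^sup>2 + (m i)\<^sup>2 - n i * m i) *
             qbinom (int (n i)) (int (n (i + 1))) *
             qbinom (int (n i) - int (n (i + 1)) + int (m (i + 1))) (int (m i))))"
      unfolding e prod1 by (rule c221)
    fix s :: nat assume "1 \<le> s \<and> s \<le> 2 + 1"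
    then consider "s = 1" | "s = 2" | "s = 3" by linarith
    then show "cp_series (3 * 2 - s, s - 1, 0) =
          1 / qpoch_inf (var_z * var_q) *
          (\<Sum>\<^sub>\<infinity>(n, m)\<in>sum_indices 2.
             var_z ^ n 1 * var_q ^ ((n 2)\<^sup>2 + (\<Sum>i=s..2. n i)) / qpoch var_q (n 1) *
             (\<Prod>i=1..2-1.
                var_q ^ ((n i)\<^sup>2 + (m i)\<^sup>2 - n i * m i + m i) *
                qbinom (int (n i)) (int (n (i + 1))) *
                qbinom (int (n i) - int (n (i + 1)) + int (m (i + 1))) (int (m i))))"
    proof cases
      case 1
      show ?thesis unfolding 1 e prod1 by (rule c500)
    next
      case 2
      show ?thesis unfolding 2 e prod1 by (rule c410)
    next
      case 3
      show ?thesis unfolding 3 e prod1 add_0_right by (rule c320)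
    qed
  qed
qed

end
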